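(* Let $\mathcal G$ be a parity game with weights with $n$ vertices and $d$ odd colors, let $b\in\mathbb N$, and let $v^*$ be a vertex of $\mathcal G$. If Player $1$ has a strategy $\tau$ in $\mathcal G$ with $\mathrm{Cost}_{v^*}(\tau)=b$, then she also has a finite-state strategy $\tau'$ with $\mathrm{Cost}_{v^*}(\tau')\ge b$ and $|\tau'|=n(2b^2+3b+2)^d$.
   Context: $\mathbb N=\{0,1,2,\dots\}$, $\mathbb N_\infty=\mathbb N\cup\{\infty\}$. An arena $\mathcal A=(V,V_0,V_1,E)$ is a finite directed graph $(V,E)$ in which every vertex has a successor, together with a partition $V=V_0\uplus V_1$ into the vertices of Player $0$ and Player $1$. A play is an infinite path. A strategy for Player $i$ is a map $\sigma:V^*V_i\to V$ with $(v,\sigma(uv))\in E$; a play $v_0v_1\cdots$ is consistent with $\sigma$ if $v_{j+1}=\sigma(v_0\cdots v_j)$ whenever $v_j\in V_i$. A memory structure $(M,\mathrm{init},\mathrm{upd})$ consists of a finite set $M$, $\mathrm{init}:V\to M$ and $\mathrm{upd}:M\times E\to M$; put $\mathrm{upd}^+(v)=\mathrm{init}(v)$ and $\mathrm{upd}^+(uvv')=\mathrm{upd}(\mathrm{upd}^+(uv),(v,v'))$. With a next-move function $\mathrm{Nxt}:V_i\times M\to V$ with $(v,\mathrm{Nxt}(v,m))\in E$ it implements the strategy $\sigma(v_0\cdots v_j)=\mathrm{Nxt}(v_j,\mathrm{upd}^+(v_0\cdots v_j))$. A strategy is finite-state if it is implemented in this way; $|\sigma|$ is the size $|M|$ of a memory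 structure implementing it. A weighting $w:E\to\mathbb Z$ is extended to finite paths by summing the weights of traversed edges (a single vertex has weight $0$). The amplitude of a finite or infinite path $\pi=v_0v_1\cdots$ is $\mathrm{Ampl}(\pi)=\sup_{j<|\pi|}|w(v_0\cdots v_j)|\in\mathbb N_\infty$. For a coloring $\Omega:V\to\mathbb N$ let $\mathrm{Ans}(c)=\{c'\in\mathbb N: c'\ge c,\ c'\text{ even}\}$. For a play $\rho=v_0v_1\cdots$ and $j\in\mathbb N$, $\mathrm{Cor}(\rho,j)=\min\{\mathrm{Ampl}(v_j\cdots v_{j'}) : j'\ge j,\ \Omega(v_{j'})\in\mathrm{Ans}(\Omega(v_j))\}$ with $\min\emptyset=\infty$. A parity game with weights is a game $(\mathcal A,\mathrm{WeightParity}(\Omega,w))$ in which Player $0$ wins exactly the plays in $\mathrm{WeightParity}(\Omega,w)=\{\rho\in V^\omega:\limsup_{j\to\infty}\mathrm{Cor}(\rho,j)\in\mathbb N\}$. The number of odd colors is the number of odd elements of $\Omega(V)$. For a strategy $\tau$ of Player $1$ and a vertex $v$, $\mathrm{Cost}_v(\tau)=\inf_\rho\limsup_{j\to\infty}\mathrm{Cor}(\rho,j)$, where $\rho$ ranges over all plays that start in $v$ and are consistent with $\tau$. *)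

theory Defs
  imports "HOL-Library.Extended_Nat" "HOL-Library.Liminf_Limsup"
begin

section \<open>Arenas, plays and strategies\<close>

locale arena =
  fixes V V\<^sub>0 V\<^sub>1 :: "'v set" and E :: "('v \<times> 'v) set"
  assumes finite_vertices: "finite V"
    and edges: "E \<subseteq> V \<times> V"
    and successor: "\<And>v. v \<in> V \<Longrightarrow> \<exists>v'. (v, v') \<in> E"
    and partition_union: "V = V\<^sub>0 \<union> V\<^sub>1"
    and partition_disjoint: "V\<^sub>0 \<inter> V\<^sub>1 = {}"

definition play :: "('v \<times> 'v) set \<Rightarrow> (nat \<Rightarrow> 'v) \<Rightarrow> bool" where
  "play E \<rho> \<longleftrightarrow> (\<forall>j. (\<rho> j, \<rho> (Suc j)) \<in> E)"

definition finite_path :: "'v set \<Rightarrow> ('v \<times> 'v) set \<Rightarrow> 'v list \<Rightarrow> bool" where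
  "finite_path V E \<pi> \<longleftrightarrow> \<pi> \<noteq> [] \<and> set \<pi> \<subseteq> V \<and> successively (\<lambda>v v'. (v, v') \<in> E) \<pi>"

text \<open>
  A player is represented by the set \<open>V\<^sub>i\<close> of her vertices. The values of the total
  function \<open>\<sigma>\<close> outside \<open>V\<^sup>* V\<^sub>i\<close> are irrelevant.
\<close>

definition strategy :: "'v set \<Rightarrow> ('v \<times> 'v) set \<Rightarrow> 'v set \<Rightarrow> ('v list \<Rightarrow> 'v) \<Rightarrow> bool" where
  "strategy V E V\<^sub>i \<sigma> \<longleftrightarrow>
     (\<forall>u v. set u \<subseteq> V \<longrightarrow> v \<in> V\<^sub>i \<longrightarrow> (v, \<sigma> (u @ [v])) \<in> E)"

definition consistent :: "'v set \<Rightarrow> ('v list \<Rightarrow> 'v) \<Rightarrow> (nat \<Rightarrow> 'v) \<Rightarrow> bool" where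
  "consistent V\<^sub>i \<sigma> \<rho> \<longleftrightarrow> (\<forall>j. \<rho> j \<in> V\<^sub>i \<longrightarrow> \<rho> (Suc j) = \<sigma> (map \<rho> [0..<Suc j]))"


section \<open>Finite-state strategies\<close>

definition memory_structure ::
  "'v set \<Rightarrow> ('v \<times> 'v) set \<Rightarrow> 'm set \<Rightarrow> ('v \<Rightarrow> 'm) \<Rightarrow> ('m \<Rightarrow> 'v \<times> 'v \<Rightarrow> 'm) \<Rightarrow> bool" where
  "memory_structure V E M init upd \<longleftrightarrow>
     finite M \<and> (\<forall>v\<in>V. init v \<in> M) \<and> (\<forall>m\<in>M. \<forall>e\<in>E. upd m e \<in> M)"

text \<open>The list \<open>zip \<pi> (tl \<pi>)\<close> consists of the edges traversed by \<open>\<pi>\<close>.\<close>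

definition upd_plus :: "('v \<Rightarrow> 'm) \<Rightarrow> ('m \<Rightarrow> 'v \<times> 'v \<Rightarrow> 'm) \<Rightarrow> 'v list \<Rightarrow> 'm" where
  "upd_plus init upd \<pi> = foldl upd (init (hd \<pi>)) (zip \<pi> (tl \<pi>))"

lemma upd_plus_single: "upd_plus init upd [v] = init v"
  by (simp add: upd_plus_def)

lemma upd_plus_snoc:
  "upd_plus init upd (u @ [v, v']) = upd (upd_plus init upd (u @ [v])) (v, v')"
proof -
  have "zip (u @ [v, v']) (tl (u @ [v, v'])) = zip (u @ [v]) (tl (u @ [v])) @ [(v, v')]"
    by (induction u rule: induct_list012) auto
  moreover have "hd (u @ [v, v']) = hd (u @ [v])"
    by (cases u) auto
  ultimately show ?thesis
    by (simp add: upd_plus_def)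
qed

definition next_move :: "('v \<times> 'v) set \<Rightarrow> 'v set \<Rightarrow> 'm set \<Rightarrow> ('v \<Rightarrow> 'm \<Rightarrow> 'v) \<Rightarrow> bool" where
  "next_move E V\<^sub>i M nxt \<longleftrightarrow> (\<forall>v\<in>V\<^sub>i. \<forall>m\<in>M. (v, nxt v m) \<in> E)"

text \<open>
  As \<open>upd\<close> is defined on \<open>M \<times> E\<close> only, \<open>upd\<^sup>+\<close> is defined on finite paths only, so these are
  the arguments on which an implemented strategy is prescribed.
\<close>

definition implements ::
  "'v set \<Rightarrow> ('v \<times> 'v) set \<Rightarrow> 'v set \<Rightarrow> ('v \<Rightarrow> 'm) \<Rightarrow> ('m \<Rightarrow> 'v \<times> 'v \<Rightarrow> 'm) \<Rightarrow>
    ('v \<Rightarrow> 'm \<Rightarrow> 'v) \<Rightarrow> ('v list \<Rightarrow> 'v) \<Rightarrow> bool" where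
  "implements V E V\<^sub>i init upd nxt \<sigma> \<longleftrightarrow>
     (\<forall>\<pi>. finite_path V E \<pi> \<longrightarrow> last \<pi> \<in> V\<^sub>i \<longrightarrow>
        \<sigma> \<pi> = nxt (last \<pi>) (upd_plus init upd \<pi>))"

text \<open>
  The strategy \<open>\<sigma>\<close> is finite-state, implemented with a memory of exactly \<open>k\<close> elements.
  Taking memory elements to be natural numbers is no restriction, as memories are finite.
\<close>

definition finite_state_strategy ::
  "'v set \<Rightarrow> ('v \<times> 'v) set \<Rightarrow> 'v set \<Rightarrow> ('v list \<Rightarrow> 'v) \<Rightarrow> nat \<Rightarrow> bool" where
  "finite_state_strategy V E V\<^sub>i \<sigma> k \<longleftrightarrow>
     strategy V E V\<^sub>i \<sigma> \<and>
     (\<exists>(M :: nat set) init upd nxt.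
        memory_structure V E M init upd \<and> next_move E V\<^sub>i M nxt \<and>
        implements V E V\<^sub>i init upd nxt \<sigma> \<and> card M = k)"


section \<open>Parity games with weights\<close>

definition path_weight :: "('v \<times> 'v \<Rightarrow> int) \<Rightarrow> 'v list \<Rightarrow> int" where
  "path_weight w \<pi> = (\<Sum>e\<leftarrow>zip \<pi> (tl \<pi>). w e)"

definition Ampl :: "('v \<times> 'v \<Rightarrow> int) \<Rightarrow> 'v list \<Rightarrow> enat" where
  "Ampl w \<pi> = (SUP j\<in>{..<length \<pi>}. enat (nat \<bar>path_weight w (take (Suc j) \<pi>)\<bar>))"

definition Ans :: "nat \<Rightarrow> nat set" where
  "Ans c = {c'. c' \<ge> c \<and> even c'}"

text \<open>In \<^typ>\<open>enat\<close> infima are minima, and \<open>Inf {} = \<infinity>\<close>.\<close>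

definition Cor :: "('v \<Rightarrow> nat) \<Rightarrow> ('v \<times> 'v \<Rightarrow> int) \<Rightarrow> (nat \<Rightarrow> 'v) \<Rightarrow> nat \<Rightarrow> enat" where
  "Cor \<Omega> w \<rho> j =
     Inf {Ampl w (map \<rho> [j..<Suc j']) | j'. j' \<ge> j \<and> \<Omega> (\<rho> j') \<in> Ans (\<Omega> (\<rho> j))}"

text \<open>
  The winning condition of Player 0. A parity game with weights is thus given by an arena
  together with \<open>\<Omega>\<close> and \<open>w\<close>, of which only the values on \<open>V\<close> and \<open>E\<close> matter.
\<close>

definition WeightParity ::
  "'v set \<Rightarrow> ('v \<Rightarrow> nat) \<Rightarrow> ('v \<times> 'v \<Rightarrow> int) \<Rightarrow> (nat \<Rightarrow> 'v) set" where
  "WeightParity V \<Omega> w = {\<rho>. range \<rho> \<subseteq> V \<and> limsup (Cor \<Omega> w \<rho>) \<noteq> \<infinity>}"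

definition num_odd_colors :: "'v set \<Rightarrow> ('v \<Rightarrow> nat) \<Rightarrow> nat" where
  "num_odd_colors V \<Omega> = card {c \<in> \<Omega> ` V. odd c}"

definition Cost ::
  "('v \<times> 'v) set \<Rightarrow> 'v set \<Rightarrow> ('v \<Rightarrow> nat) \<Rightarrow> ('v \<times> 'v \<Rightarrow> int) \<Rightarrow> 'v \<Rightarrow> ('v list \<Rightarrow> 'v) \<Rightarrow> enat" where
  "Cost E V\<^sub>1 \<Omega> w v \<tau> =
     Inf {limsup (Cor \<Omega> w \<rho>) | \<rho>. play E \<rho> \<and> \<rho> 0 = v \<and> consistent V\<^sub>1 \<tau> \<rho>}"

end

theory Submission
  imports Defs "HOL-Library.Infinite_Set" "HOL-Library.FuncSet"
begin

text \<open>
  For \<open>b > 0\<close>, a play satisfies \<open>limsup Cor \<ge> b\<close> iff infinitely many of its requests are not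
  answered before reaching amplitude \<open>b\<close>. A finite memory can detect this: for every odd color it
  stores the range of the weights accumulated by the open requests of that color, which lies
  strictly between \<open>-b\<close> and \<open>b\<close>; when this bound is violated, the memory signals an overflow and
  is reset. Giving overflows a large odd color, the plays with \<open>limsup Cor \<ge> b\<close> are those
  that satisfy an ordinary parity condition on the product of the arena with the memory: without
  infinitely many overflows, almost all requests of the required kind are never answered. By
  positional determinacy of finite parity games (Zielonka's induction), either Player 1 has a
  winning strategy using this memory, or Player 0 has one, which played against \<open>\<tau>\<close> yields a play
  of cost less than \<open>b\<close>. The memory has at most \<open>(2b\<^sup>2 - b + 1)\<^sup>d + 1\<close> states.
\<close>

section \<open>Positional determinacy of finite parity games\<close>

text \<open>The Boolean \<open>i\<close> names a player: \<open>True\<close> stands for the one who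
  wins on odd colors. The witness \<open>c\<close> is the greatest color that occurs infinitely
  often.\<close>

definition parity_wins :: "bool \<Rightarrow> (nat \<Rightarrow> nat) \<Rightarrow> bool" where
  "parity_wins i f \<longleftrightarrow> (\<exists>c. odd c = i \<and> (\<exists>\<^sub>\<infinity>k. f k = c) \<and> (\<forall>\<^sub>\<infinity>k. f k \<le> c))"

text \<open>A color that occurs infinitely often is below every eventual upper bound. Two witnesses
  therefore bound each other and coincide, and so do their parities.\<close>

lemma parity_wins_unique:
  assumes "parity_wins i f" "parity_wins i' f"
  shows "i = i'"
proof -
  have "c \<le> c'" if "\<exists>\<^sub>\<infinity>k. f k = c" "\<forall>\<^sub>\<infinity>k. f k \<le> c'" for c c'
    using that by (auto simp: INFM_nat_le MOST_nat_le)
  with assms show ?thesis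
    unfolding parity_wins_def by (metis le_antisym)
qed

lemma parity_wins_shift:
  assumes "parity_wins i (\<lambda>k. f (k + n))"
  shows "parity_wins i f"
proof -
  obtain c m where c: "odd c = i" and inf: "\<forall>m. \<exists>k\<ge>m. f (k + n) = c"
    and m: "\<And>k. k \<ge> m \<Longrightarrow> f (k + n) \<le> c"
    using assms unfolding parity_wins_def INFM_nat_le MOST_nat_le by blast
  have "f k \<le> c" if "k \<ge> m + n" for k
    using m[of "k - n"] that by simp
  moreover have "\<forall>m. \<exists>k\<ge>m. f k = c"
    using inf by (meson le_add1 le_trans)
  ultimately show ?thesis
    unfolding parity_wins_def INFM_nat_le MOST_nat_le using c by blast
qed

text \<open>The color is the least eventual upper bound. If it occurred only finitely often, its
  predecessor would be an eventual bound too.\<close>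

lemma limsup_color:
  fixes f :: "nat \<Rightarrow> nat"
  assumes "\<And>k. f k \<le> B"
  obtains c where "\<exists>\<^sub>\<infinity>k. f k = c" "\<forall>\<^sub>\<infinity>k. f k \<le> c"
proof -
  define c where "c = (LEAST c. \<forall>\<^sub>\<infinity>k. f k \<le> c)"
  have ex: "\<forall>\<^sub>\<infinity>k. f k \<le> B" using assms by simp
  have c: "\<forall>\<^sub>\<infinity>k. f k \<le> c" unfolding c_def by (rule LeastI[of _ B]) (rule ex)
  have "\<exists>\<^sub>\<infinity>k. f k = c"
  proof (rule ccontr)
    assume "\<not> (\<exists>\<^sub>\<infinity>k. f k = c)"
    then have "\<forall>\<^sub>\<infinity>k. f k \<noteq> c" by (simp add: not_INFM)
    with c have less: "\<forall>\<^sub>\<infinity>k. f k < c" by eventually_elim simp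
    \<comment> \<open>A single instance of the strict inequality makes \<open>c\<close> positive, so
      that the truncated \<open>c - 1\<close> is really smaller.\<close>
    then obtain k where "f k < c" by (auto simp: MOST_nat_le)
    then have "c - 1 < c" by simp
    moreover have "\<forall>\<^sub>\<infinity>k. f k \<le> c - 1" using less by eventually_elim simp
    ultimately show False unfolding c_def using not_less_Least by blast
  qed
  with c that show thesis by blast
qed

section \<open>Subgames, winning regions and attractors\<close>

text \<open>The set of positions is left out of the locale, because the induction passes to
  subgames; these are given by sets \<open>U\<close> of positions.\<close>

locale parity_game =
  fixes F :: "('s \<times> 's) set" and owner :: "'s \<Rightarrow> bool" and col :: "'s \<Rightarrow> nat"
begin

definition total_on :: "'s set \<Rightarrow> bool" where
  "total_on U \<longleftrightarrow> (\<forall>s\<in>U. \<exists>t\<in>U. (s, t) \<in> F)"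

definition positional_play :: "bool \<Rightarrow> ('s \<Rightarrow> 's) \<Rightarrow> 's set \<Rightarrow> (nat \<Rightarrow> 's) \<Rightarrow> bool" where
  "positional_play i \<sigma> X \<rho> \<longleftrightarrow>
     (\<forall>k. \<rho> k \<in> X \<and> (\<rho> k, \<rho> (Suc k)) \<in> F \<and> (owner (\<rho> k) = i \<longrightarrow> \<rho> (Suc k) = \<sigma> (\<rho> k)))"

text \<open>Winning regions are required to be closed under the moves that \<open>\<sigma>\<close> leaves open, so that
  plays never leave them.\<close>

definition wins :: "'s set \<Rightarrow> bool \<Rightarrow> ('s \<Rightarrow> 's) \<Rightarrow> 's set \<Rightarrow> bool" where
  "wins U i \<sigma> X \<longleftrightarrow> X \<subseteq> U \<and>
     (\<forall>s\<in>X. owner s = i \<longrightarrow> \<sigma> s \<in> X \<and> (s, \<sigma> s) \<in> F) \<and>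
     (\<forall>s\<in>X. owner s \<noteq> i \<longrightarrow> (\<forall>t\<in>U. (s, t) \<in> F \<longrightarrow> t \<in> X)) \<and>
     (\<forall>\<rho>. positional_play i \<sigma> X \<rho> \<longrightarrow> parity_wins i (\<lambda>k. col (\<rho> k)))"

text \<open>The rank \<open>r\<close> certifies that player \<open>i\<close> can force a visit to
  \<open>N\<close> from all of \<open>A\<close>: outside \<open>N\<close> it decreases along
  \<sigma> and along every move of the opponent. Maximality of \<open>A\<close> is left to
  \<open>attractor\<close>, so that \<open>A\<close> can grow by one position at a time.\<close>

definition attracted :: "'s set \<Rightarrow> bool \<Rightarrow> 's set \<Rightarrow> ('s \<Rightarrow> 's) \<Rightarrow> ('s \<Rightarrow> nat) \<Rightarrow> 's set \<Rightarrow> bool" where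
  "attracted U i N \<sigma> r A \<longleftrightarrow> N \<subseteq> A \<and> A \<subseteq> U \<and>
     (\<forall>s\<in>A - N. owner s = i \<longrightarrow> (s, \<sigma> s) \<in> F \<and> \<sigma> s \<in> A \<and> r (\<sigma> s) < r s) \<and>
     (\<forall>s\<in>A - N. owner s \<noteq> i \<longrightarrow> (\<forall>t\<in>U. (s, t) \<in> F \<longrightarrow> t \<in> A \<and> r t < r s))"

lemma attracted_subset: "attracted U i N \<sigma> r A \<Longrightarrow> N \<subseteq> A \<and> A \<subseteq> U"
  by (simp add: attracted_def)

text \<open>The new position needs a rank above those of all its relevant successors;
  \<open>Suc (sum r A)\<close> exceeds every rank on the finite set \<open>A\<close>.\<close>

lemma attracted_insert:
  assumes A: "attracted U i N \<sigma> r A" and "finite U" and s: "s \<in> U - A"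
    and t: "owner s = i \<Longrightarrow> t \<in> A \<and> (s, t) \<in> F"
    and no_escape: "owner s \<noteq> i \<Longrightarrow> \<forall>t\<in>U. (s, t) \<in> F \<longrightarrow> t \<in> A"
  shows "attracted U i N (\<sigma>(s := t)) (r(s := Suc (sum r A))) (insert s A)"
proof -
  have "finite A" using attracted_subset[OF A] \<open>finite U\<close> by (auto intro: finite_subset)
  then have le: "r a < Suc (sum r A)" if "a \<in> A" for a
    using that by (simp add: member_le_sum less_Suc_eq_le)
  have "s \<notin> A" "s \<in> U" using s by auto
  have N: "N \<subseteq> A" "A \<subseteq> U"
    and own: "\<And>x. x \<in> A - N \<Longrightarrow> owner x = i \<Longrightarrow> (x, \<sigma> x) \<in> F \<and> \<sigma> x \<in> A \<and> r (\<sigma> x) < r x"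
    and opp: "\<And>x y. x \<in> A - N \<Longrightarrow> owner x \<noteq> i \<Longrightarrow> y \<in> U \<Longrightarrow> (x, y) \<in> F \<Longrightarrow> y \<in> A \<and> r y < r x"
    using A unfolding attracted_def by blast+
  have upd: "(\<sigma>(s := t)) a = \<sigma> a" "(r(s := Suc (sum r A))) a = r a" if "a \<in> A" for a
    using that \<open>s \<notin> A\<close> by auto
  show ?thesis
    unfolding attracted_def
  proof (intro conjI ballI impI)
    fix x assume "x \<in> insert s A - N" "owner x = i"
    then have "(x, (\<sigma>(s := t)) x) \<in> F \<and> (\<sigma>(s := t)) x \<in> A \<and>
      (r(s := Suc (sum r A))) ((\<sigma>(s := t)) x) < (r(s := Suc (sum r A))) x"
    proof (cases "x = s")
      case True
      then show ?thesis using t le upd \<open>owner x = i\<close> by simp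
    next
      case False
      then show ?thesis using own[of x] upd \<open>x \<in> insert s A - N\<close> \<open>owner x = i\<close> by simp
    qed
    then show "(x, (\<sigma>(s := t)) x) \<in> F" "(\<sigma>(s := t)) x \<in> insert s A"
      "(r(s := Suc (sum r A))) ((\<sigma>(s := t)) x) < (r(s := Suc (sum r A))) x" by simp_all
  next
    fix x y assume "x \<in> insert s A - N" "owner x \<noteq> i" "y \<in> U" "(x, y) \<in> F"
    then have "y \<in> A \<and> (r(s := Suc (sum r A))) y < (r(s := Suc (sum r A))) x"
    proof (cases "x = s")
      case True
      then have "y \<in> A" using no_escape \<open>owner x \<noteq> i\<close> \<open>y \<in> U\<close> \<open>(x, y) \<in> F\<close> by blast
      then show ?thesis using True le upd by simp
    next
      case False
      then have "x \<in> A - N" using \<open>x \<in> insert s A - N\<close> by simp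
      with opp[of x y] have "y \<in> A \<and> r y < r x" using \<open>owner x \<noteq> i\<close> \<open>y \<in> U\<close> \<open>(x, y) \<in> F\<close> by blast
      then show ?thesis using upd \<open>x \<in> A - N\<close> by simp
    qed
    then show "y \<in> insert s A" "(r(s := Suc (sum r A))) y < (r(s := Suc (sum r A))) x" by simp_all
  qed (use N \<open>s \<in> U\<close> in auto)
qed

text \<open>An attracted set of greatest cardinality admits no further insertion. Hence outside it
  player \<open>i\<close> has no move into it, and the opponent always has a move avoiding it. Both
  facts together make the remaining subgame total.\<close>

lemma attractor:
  assumes "finite U" "N \<subseteq> U" "total_on U"
  obtains A \<sigma> r where "attracted U i N \<sigma> r A"
    "\<And>s t. s \<in> U - A \<Longrightarrow> owner s = i \<Longrightarrow> t \<in> U \<Longrightarrow> (s, t) \<in> F \<Longrightarrow> t \<notin> A"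
    "total_on (U - A)"
proof -
  define Q where "Q A \<longleftrightarrow> (\<exists>\<sigma> r. attracted U i N \<sigma> r A)" for A
  have "attracted U i N id (\<lambda>_. 0) N" using assms by (simp add: attracted_def)
  then have "Q N" unfolding Q_def by blast
  moreover have "\<forall>A. Q A \<longrightarrow> card A < Suc (card U)"
    unfolding Q_def
  proof (intro allI impI, elim exE)
    fix A \<sigma> r assume "attracted U i N \<sigma> r A"
    from attracted_subset[OF this] show "card A < Suc (card U)"
      using assms(1) by (simp add: card_mono less_Suc_eq_le)
  qed
  ultimately obtain A where "Q A" and max: "\<And>B. Q B \<Longrightarrow> card B \<le> card A"
    using ex_has_greatest_nat[of Q N card "Suc (card U)"] by blast
  then obtain \<sigma> r where A: "attracted U i N \<sigma> r A" by (auto simp: Q_def)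
  have "finite A" using attracted_subset[OF A] assms(1) by (auto intro: finite_subset)
  have stuck: "\<not> (t \<in> A \<and> (s, t) \<in> F)" if "s \<in> U - A" "owner s = i" for s t
  proof
    assume "t \<in> A \<and> (s, t) \<in> F"
    then have "Q (insert s A)"
      unfolding Q_def using attracted_insert[OF A assms(1) that(1), of t] that(2) by blast
    then show False using max[of "insert s A"] that(1) \<open>finite A\<close> by auto
  qed
  have stuck': "\<exists>t\<in>U - A. (s, t) \<in> F" if "s \<in> U - A" "owner s \<noteq> i" for s
  proof (rule ccontr)
    assume "\<not> (\<exists>t\<in>U - A. (s, t) \<in> F)"
    then have "Q (insert s A)"
      unfolding Q_def using attracted_insert[OF A assms(1) that(1)] that(2) by blast
    then show False using max[of "insert s A"] that(1) \<open>finite A\<close> by auto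
  qed
  have "total_on (U - A)"
    using stuck stuck' assms(3) unfolding total_on_def by (metis Diff_iff)
  with that[OF A] stuck show thesis by blast
qed

text \<open>Induction on the rank of the current position. Player \<open>i\<close> is bound to
  \<sigma> on \<open>A - N\<close> only, so the lemma applies to strategies that are composed of
  several pieces.\<close>

lemma attracted_reaches:
  assumes A: "attracted U i N \<sigma> r A"
    and \<rho>: "\<And>k. \<rho> k \<in> U \<and> (\<rho> k, \<rho> (Suc k)) \<in> F \<and>
      (\<rho> k \<in> A - N \<longrightarrow> owner (\<rho> k) = i \<longrightarrow> \<rho> (Suc k) = \<sigma> (\<rho> k))"
    and "\<rho> k \<in> A"
  shows "\<exists>k'\<ge>k. \<rho> k' \<in> N"
  using \<open>\<rho> k \<in> A\<close>
proof (induction "r (\<rho> k)" arbitrary: k rule: less_induct)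
  case less
  show ?case
  proof (cases "\<rho> k \<in> N")
    case False
    then have "\<rho> (Suc k) \<in> A \<and> r (\<rho> (Suc k)) < r (\<rho> k)"
      using A \<rho>[of k] \<rho>[of "Suc k"] less.prems unfolding attracted_def by (metis Diff_iff)
    then show ?thesis using less.hyps[of "Suc k"] by (meson Suc_leD)
  qed auto
qed

section \<open>Zielonka's induction\<close>

text \<open>Let \<open>j\<close> be the player favored by the greatest color \<open>d\<close>, and
  remove the attractor \<open>A\<close> of the positions of color \<open>d\<close>. If
  \<open>j\<close> wins the whole rest, then \<open>j\<close> wins all of \<open>U\<close>.
  Otherwise the attractor \<open>B\<close> of the opponent's part \<open>Y\<close> of the rest is
  won by the opponent, and the induction hypothesis for \<open>U - B\<close> settles the remaining
  positions.\<close>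

lemma positional_determinacy:
  assumes "finite U" "total_on U"
  shows "\<exists>X \<sigma> \<sigma>'. wins U i \<sigma> X \<and> wins U (\<not> i) \<sigma>' (U - X)"
  using assms
proof (induction "card U" arbitrary: U i rule: less_induct)
  case less
  show ?case
  proof (cases "U = {}")
    case True
    then show ?thesis by (auto simp: wins_def positional_play_def)
  next
    case False
    define d where "d = Max (col ` U)"
    define N where "N = {s \<in> U. col s = d}"
    define j where "j = odd d"
    have le_d: "col s \<le> d" if "s \<in> U" for s
      using that less.prems by (simp add: d_def)
    have "d \<in> col ` U" using False less.prems by (simp add: d_def)
    then have "N \<noteq> {}" "N \<subseteq> U" by (auto simp: N_def)
    \<comment> \<open>The statement for \<open>j\<close> suffices: for the other player the two
      regions swap roles.\<close>
    have "\<exists>X \<sigma> \<sigma>'. wins U j \<sigma> X \<and> wins U (\<not> j) \<sigma>' (U - X)"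
    proof -
      obtain A \<alpha> r where A: "attracted U j N \<alpha> r A"
        and A_trap: "\<And>s t. s \<in> U - A \<Longrightarrow> owner s = j \<Longrightarrow> t \<in> U \<Longrightarrow> (s, t) \<in> F \<Longrightarrow> t \<notin> A"
        and A_total: "total_on (U - A)"
        using attractor[OF less.prems(1) \<open>N \<subseteq> U\<close> less.prems(2), of j] by metis
      have "N \<subseteq> A" "A \<subseteq> U" using attracted_subset[OF A] by auto
      have "card (U - A) < card U"
        using \<open>N \<noteq> {}\<close> \<open>N \<subseteq> A\<close> \<open>A \<subseteq> U\<close> less.prems(1) by (intro psubset_card_mono) auto
      then obtain X' \<sigma>' \<tau>' where X': "wins (U - A) j \<sigma>' X'"
        and Y': "wins (U - A) (\<not> j) \<tau>' (U - A - X')"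
        using less.hyps[of "U - A"] less.prems(1) A_total by blast
      show ?thesis
      proof (cases "U - A - X' = {}")
        case True
        then have X'_eq: "X' = U - A" using X' by (auto simp: wins_def)
        obtain nx where nx: "\<And>s. s \<in> U \<Longrightarrow> nx s \<in> U \<and> (s, nx s) \<in> F"
          using less.prems(2) unfolding total_on_def by metis
        \<comment> \<open>Any move will do on \<open>N\<close>. A play that visits \<open>A\<close>
          infinitely often is attracted to \<open>N\<close> infinitely often and sees
          \<open>d\<close> again and again; every other play finally stays in \<open>U - A\<close>
          and follows \<sigma>' there.\<close>
        define \<sigma> where "\<sigma> s = (if s \<in> N then nx s else if s \<in> A then \<alpha> s else \<sigma>' s)" for s
        have "wins U j \<sigma> U"
          unfolding wins_def
        proof (intro conjI allI impI ballI)
          fix s assume s: "s \<in> U" and own: "owner s = j"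
          have "\<alpha> s \<in> A \<and> (s, \<alpha> s) \<in> F" if "s \<in> A - N"
            using A own that unfolding attracted_def by blast
          moreover have "\<sigma>' s \<in> U - A \<and> (s, \<sigma>' s) \<in> F" if "s \<in> U - A"
            using X' own that unfolding wins_def X'_eq by blast
          ultimately show "\<sigma> s \<in> U" "(s, \<sigma> s) \<in> F"
            using s nx[OF s] \<open>A \<subseteq> U\<close> \<open>N \<subseteq> A\<close> unfolding \<sigma>_def by auto
        next
          fix \<rho> assume \<rho>: "positional_play j \<sigma> U \<rho>"
          then have U: "\<rho> k \<in> U" and step: "(\<rho> k, \<rho> (Suc k)) \<in> F" for k
            by (auto simp: positional_play_def)
          show "parity_wins j (\<lambda>k. col (\<rho> k))"
          proof (cases "\<exists>\<^sub>\<infinity>k. \<rho> k \<in> A")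
            case True
            have "\<exists>k'\<ge>k. \<rho> k' \<in> N" if "\<rho> k \<in> A" for k
              using A _ that
            proof (rule attracted_reaches)
              show "\<rho> k \<in> U \<and> (\<rho> k, \<rho> (Suc k)) \<in> F \<and>
                (\<rho> k \<in> A - N \<longrightarrow> owner (\<rho> k) = j \<longrightarrow> \<rho> (Suc k) = \<alpha> (\<rho> k))" for k
                using \<rho> by (auto simp: positional_play_def \<sigma>_def)
            qed
            then have "\<exists>\<^sub>\<infinity>k. col (\<rho> k) = d"
              using True unfolding INFM_nat_le N_def
              by (metis (mono_tags, lifting) le_trans mem_Collect_eq)
            then show ?thesis
              unfolding parity_wins_def using le_d U j_def by (intro exI[of _ d]) auto
          next
            case False
            then obtain n where n: "\<And>k. k \<ge> n \<Longrightarrow> \<rho> k \<notin> A"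
              by (auto simp: INFM_nat_le)
            have "positional_play j \<sigma>' X' (\<lambda>k. \<rho> (k + n))"
              using \<rho> n \<open>N \<subseteq> A\<close> by (auto simp: positional_play_def X'_eq \<sigma>_def)
            then show ?thesis
              using X' parity_wins_shift[of j "\<lambda>k. col (\<rho> k)" n] by (auto simp: wins_def)
          qed
        qed auto
        moreover have "wins U (\<not> j) \<sigma> (U - U)" by (simp add: wins_def positional_play_def)
        ultimately show ?thesis by blast
      next
        case False
        define Y where "Y = U - A - X'"
        have "Y \<subseteq> U" by (auto simp: Y_def)
        obtain B \<beta> r' where B: "attracted U (\<not> j) Y \<beta> r' B"
          and B_trap: "\<And>s t. s \<in> U - B \<Longrightarrow> owner s = (\<not> j) \<Longrightarrow> t \<in> U \<Longrightarrow> (s, t) \<in> F \<Longrightarrow> t \<notin> B"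
          and B_total: "total_on (U - B)"
          using attractor[OF less.prems(1) \<open>Y \<subseteq> U\<close> less.prems(2), of "\<not> j"] by metis
        have "Y \<subseteq> B" "B \<subseteq> U" using attracted_subset[OF B] by auto
        have "card (U - B) < card U"
          using False \<open>Y \<subseteq> B\<close> \<open>B \<subseteq> U\<close> less.prems(1)
          by (intro psubset_card_mono) (auto simp: Y_def)
        then obtain X'' \<sigma>'' \<tau>'' where X'': "wins (U - B) j \<sigma>'' X''"
          and Y'': "wins (U - B) (\<not> j) \<tau>'' (U - B - X'')"
          using less.hyps[of "U - B"] less.prems(1) B_total by blast
        \<comment> \<open>By \<open>B_trap\<close> the opponent has no move from
          \<open>U - B\<close> into \<open>B\<close>, so a region of \<open>j\<close> in the subgame
          remains closed in \<open>U\<close>.\<close>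
        have "wins U j \<sigma>'' X''"
          using X'' B_trap unfolding wins_def by blast
        moreover
        \<comment> \<open>A play that meets \<open>B\<close> is attracted to \<open>Y\<close> and
          then trapped there, following \<tau>'; a play that avoids \<open>B\<close> is a play of
          the subgame \<open>U - B\<close> following \<tau>''.\<close>
        define \<tau> where "\<tau> s = (if s \<in> Y then \<tau>' s else if s \<in> B then \<beta> s else \<tau>'' s)" for s
        have "X'' \<subseteq> U - B" using X'' by (auto simp: wins_def)
        \<comment> \<open>Player \<open>j\<close> could leave \<open>Y\<close> only into
          \<open>A\<close>, and \<open>A_trap\<close> excludes this.\<close>
        have Y_closed: "t \<in> Y" if "s \<in> Y" "owner s = j" "t \<in> U" "(s, t) \<in> F" for s t
        proof -
          have "t \<notin> A" using A_trap[of s t] that by (auto simp: Y_def)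
          then show ?thesis using Y' that unfolding wins_def Y_def by blast
        qed
        have "wins U (\<not> j) \<tau> (U - X'')"
          unfolding wins_def
        proof (intro conjI allI impI ballI)
          fix s assume s: "s \<in> U - X''" and own: "owner s = (\<not> j)"
          consider "s \<in> Y" | "s \<in> B - Y" | "s \<in> U - B - X''" using s \<open>Y \<subseteq> B\<close> by blast
          then have "(\<tau> s \<in> B \<or> \<tau> s \<in> U - B - X'') \<and> (s, \<tau> s) \<in> F"
          proof cases
            case 1
            then have "\<tau>' s \<in> Y \<and> (s, \<tau>' s) \<in> F" using Y' own unfolding wins_def Y_def by blast
            then show ?thesis using 1 \<open>Y \<subseteq> B\<close> by (auto simp: \<tau>_def)
          next
            case 2
            then have "\<beta> s \<in> B \<and> (s, \<beta> s) \<in> F" using B own unfolding attracted_def by blast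
            then show ?thesis using 2 by (auto simp: \<tau>_def)
          next
            case 3
            then have "\<tau>'' s \<in> U - B - X'' \<and> (s, \<tau>'' s) \<in> F" using Y'' own unfolding wins_def by blast
            then show ?thesis using 3 \<open>Y \<subseteq> B\<close> by (auto simp: \<tau>_def)
          qed
          then show "\<tau> s \<in> U - X''" "(s, \<tau> s) \<in> F"
            using \<open>X'' \<subseteq> U - B\<close> \<open>B \<subseteq> U\<close> by auto
        next
          fix s t assume s: "s \<in> U - X''" and own: "owner s \<noteq> (\<not> j)"
            and t: "t \<in> U" "(s, t) \<in> F"
          consider "s \<in> Y" | "s \<in> B - Y" | "s \<in> U - B - X''" using s \<open>Y \<subseteq> B\<close> by blast
          then have "t \<in> B \<or> t \<in> U - B - X''"
          proof cases
            case 1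
            then show ?thesis using Y_closed[of s t] own t \<open>Y \<subseteq> B\<close> by auto
          next
            case 2
            then show ?thesis using B own t unfolding attracted_def by blast
          next
            case 3
            then show ?thesis using Y'' own t unfolding wins_def by blast
          qed
          then show "t \<in> U - X''" using \<open>X'' \<subseteq> U - B\<close> \<open>B \<subseteq> U\<close> by auto
        next
          fix \<rho> assume \<rho>: "positional_play (\<not> j) \<tau> (U - X'') \<rho>"
          then have U: "\<rho> k \<in> U" and step: "(\<rho> k, \<rho> (Suc k)) \<in> F"
            and strat: "owner (\<rho> k) \<noteq> j \<Longrightarrow> \<rho> (Suc k) = \<tau> (\<rho> k)" for k
            by (auto simp: positional_play_def)
          show "parity_wins (\<not> j) (\<lambda>k. col (\<rho> k))"
          proof (cases "\<exists>k. \<rho> k \<in> B")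
            case True
            then obtain k where "\<rho> k \<in> B" by blast
            with B _ have "\<exists>k'\<ge>k. \<rho> k' \<in> Y"
            proof (rule attracted_reaches)
              show "\<rho> k \<in> U \<and> (\<rho> k, \<rho> (Suc k)) \<in> F \<and>
                (\<rho> k \<in> B - Y \<longrightarrow> owner (\<rho> k) = (\<not> j) \<longrightarrow> \<rho> (Suc k) = \<beta> (\<rho> k))" for k
                using \<rho> by (auto simp: positional_play_def \<tau>_def)
            qed
            then obtain n where n: "\<rho> n \<in> Y" by blast
            have inY: "\<rho> (k + n) \<in> Y" for k
            proof (induction k)
              case (Suc k)
              show ?case
              proof (cases "owner (\<rho> (k + n)) = j")
                case True
                then show ?thesis using Suc Y_closed U step[of "k + n"] by auto
              next
                case False
                then have "\<tau>' (\<rho> (k + n)) \<in> Y"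
                  using Suc Y' unfolding wins_def Y_def by blast
                then show ?thesis using Suc False strat[of "k + n"] by (simp add: \<tau>_def)
              qed
            qed (use n in simp)
            then have "positional_play (\<not> j) \<tau>' (U - A - X') (\<lambda>k. \<rho> (k + n))"
              using step strat unfolding positional_play_def Y_def[symmetric] by (auto simp: \<tau>_def)
            then show ?thesis
              using Y' parity_wins_shift[of "\<not> j" "\<lambda>k. col (\<rho> k)" n] unfolding wins_def by blast
          next
            case False
            then have "positional_play (\<not> j) \<tau>'' (U - B - X'') \<rho>"
              using \<rho> \<open>Y \<subseteq> B\<close> unfolding positional_play_def \<tau>_def by auto
            then show ?thesis using Y'' by (auto simp: wins_def)
          qed
        qed auto
        ultimately show ?thesis by blast
      qed
    qed
    then obtain X \<sigma> \<sigma>' where X: "wins U j \<sigma> X" "wins U (\<not> j) \<sigma>' (U - X)" by blast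
    show ?thesis
    proof (cases "i = j")
      case True
      then show ?thesis using X by blast
    next
      case False
      moreover have "U - (U - X) = X" using X by (auto simp: wins_def)
      ultimately show ?thesis using X by (intro exI[of _ "U - X"]) auto
    qed
  qed
qed

end


section \<open>Finite-memory determinacy\<close>

definition memory_at ::
  "('v \<Rightarrow> 'm) \<Rightarrow> ('m \<Rightarrow> 'v \<times> 'v \<Rightarrow> 'm) \<Rightarrow> (nat \<Rightarrow> 'v) \<Rightarrow> nat \<Rightarrow> 'm" where
  "memory_at init upd \<rho> k = upd_plus init upd (map \<rho> [0..<Suc k])"

lemma memory_at_0: "memory_at init upd \<rho> 0 = init (\<rho> 0)"
  by (simp add: memory_at_def upd_plus_single)

lemma memory_at_Suc:
  "memory_at init upd \<rho> (Suc k) = upd (memory_at init upd \<rho> k) (\<rho> k, \<rho> (Suc k))"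
  using upd_plus_snoc[of init upd "map \<rho> [0..<k]" "\<rho> k" "\<rho> (Suc k)"] by (simp add: memory_at_def)

lemma play_in_vertices: "arena V V\<^sub>0 V\<^sub>1 E \<Longrightarrow> play E \<rho> \<Longrightarrow> \<rho> k \<in> V"
  using arena.edges by (fastforce simp: play_def)

lemma memory_at_in:
  assumes "arena V V\<^sub>0 V\<^sub>1 E" "memory_structure V E M init upd" "play E \<rho>"
  shows "memory_at init upd \<rho> k \<in> M"
proof (induction k)
  case 0
  then show ?case
    using assms play_in_vertices[of V V\<^sub>0 V\<^sub>1 E \<rho> 0] by (simp add: memory_at_0 memory_structure_def)
next
  case (Suc k)
  then show ?case using assms by (simp add: memory_at_Suc memory_structure_def play_def)
qed

lemma finite_path_prefix:
  assumes "arena V V\<^sub>0 V\<^sub>1 E" "play E \<rho>"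
  shows "finite_path V E (map \<rho> [0..<Suc k])"
proof -
  have "set (map \<rho> [0..<Suc k]) \<subseteq> V" using play_in_vertices[OF assms] by auto
  moreover have "successively (\<lambda>v v'. (v, v') \<in> E) (map \<rho> [0..<Suc k])"
    using assms(2) by (induction k) (auto simp: successively_append_iff play_def)
  ultimately show ?thesis by (simp add: finite_path_def)
qed

lemma finite_path_snoc:
  "finite_path V E (\<pi> @ [v]) \<longleftrightarrow> v \<in> V \<and> (\<pi> = [] \<or> finite_path V E \<pi> \<and> (last \<pi>, v) \<in> E)"
  by (auto simp: finite_path_def successively_append_iff)

lemma upd_plus_snoc': "\<pi> \<noteq> [] \<Longrightarrow>
  upd_plus init upd (\<pi> @ [v]) = upd (upd_plus init upd \<pi>) (last \<pi>, v)"
  by (metis append.assoc append_Cons append_Nil append_butlast_last_id upd_plus_snoc)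

lemma upd_plus_in:
  assumes "memory_structure V E M init upd" "finite_path V E \<pi>"
  shows "upd_plus init upd \<pi> \<in> M"
  using assms(2)
proof (induction \<pi> rule: rev_induct)
  case (snoc v \<pi>)
  then show ?case
    using assms(1)
    by (cases "\<pi> = []")
      (auto simp: finite_path_snoc[of _ _ \<pi>] finite_path_snoc[of _ _ "[]", simplified]
        upd_plus_single upd_plus_snoc' memory_structure_def)
qed (simp add: finite_path_def)

text \<open>An injection renames the states of \<open>M\<close> to numbers below \<open>k\<close>.
  The surplus numbers are never reached; they pad the memory, which must have exactly
  \<open>k\<close> elements, and get arbitrary legal updates and moves.\<close>

lemma implementation_with_nat_memory:
  fixes M :: "'m set"
  assumes A: "arena V V\<^sub>0 V\<^sub>1 E" and M: "memory_structure V E M init upd"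
    and nxt: "next_move E V\<^sub>1 M nxt" and "card M \<le> k"
  shows "\<exists>\<tau>. finite_state_strategy V E V\<^sub>1 \<tau> k \<and> implements V E V\<^sub>1 init upd nxt \<tau>"
proof -
  have "V\<^sub>1 \<subseteq> V" using arena.partition_union[OF A] by blast
  then obtain sc where sc: "\<And>v. v \<in> V\<^sub>1 \<Longrightarrow> (v, sc v) \<in> E"
    using arena.successor[OF A] by (metis subsetD)
  \<comment> \<open>An implementation prescribes moves after finite paths only, whereas
    \<open>strategy\<close> asks for an edge after every list of vertices ending in
    \<open>V\<^sub>1\<close>; the default \<open>sc\<close> fills the gap.\<close>
  define \<tau> where "\<tau> \<pi> =
    (if finite_path V E \<pi> then nxt (last \<pi>) (upd_plus init upd \<pi>) else sc (last \<pi>))" for \<pi>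
  have "finite M" using M by (simp add: memory_structure_def)
  then obtain f where f: "inj_on f M" "f ` M \<subseteq> {..<k}"
    using card_le_inj[of M "{..<k}"] \<open>card M \<le> k\<close> by auto
  define upd' where "upd' m e = (if m \<in> f ` M then f (upd (inv_into M f m) e) else m)" for m e
  define nxt' where "nxt' v m = (if m \<in> f ` M then nxt v (inv_into M f m) else sc v)" for v m
  have "memory_structure V E {..<k} (f \<circ> init) upd'"
    using M f by (auto simp: memory_structure_def upd'_def inv_into_f_f image_subset_iff)
  moreover have "next_move E V\<^sub>1 {..<k} nxt'"
    using nxt sc f by (auto simp: next_move_def nxt'_def inv_into_f_f)
  moreover have "implements V E V\<^sub>1 (f \<circ> init) upd' nxt' \<tau>"
  proof -
    have "upd_plus (f \<circ> init) upd' \<pi> = f (upd_plus init upd \<pi>)" if "finite_path V E \<pi>" for \<pi>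
      using that
    proof (induction \<pi> rule: rev_induct)
      case (snoc v \<pi>)
      show ?case
      proof (cases "\<pi> = []")
        case False
        then have "finite_path V E \<pi>" using snoc.prems by (simp add: finite_path_snoc)
        with False snoc.IH upd_plus_in[OF M this] f show ?thesis
          by (simp add: upd_plus_snoc' upd'_def inv_into_f_f)
      qed (simp add: upd_plus_single)
    qed (simp add: finite_path_def)
    then show ?thesis
      using upd_plus_in[OF M] f by (auto simp: implements_def \<tau>_def nxt'_def inv_into_f_f)
  qed
  moreover have "strategy V E V\<^sub>1 \<tau>"
    using sc nxt upd_plus_in[OF M] by (auto simp: strategy_def \<tau>_def next_move_def)
  ultimately have "finite_state_strategy V E V\<^sub>1 \<tau> k"
    unfolding finite_state_strategy_def by (metis card_lessThan)
  then show ?thesis by (auto simp: implements_def \<tau>_def)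
qed

section \<open>The product of the arena with a memory structure\<close>

text \<open>A positional strategy of Player 1 in the product is a next-move function for this
  memory. If Player 0 won the initial position, Player 0's positional strategy played against \<tau>
  would yield a play won by both players.\<close>

lemma finite_memory_determinacy:
  fixes M :: "'m set" and col :: "'v \<times> 'm \<Rightarrow> nat"
  assumes A: "arena V V\<^sub>0 V\<^sub>1 E" and M: "memory_structure V E M init upd"
    and "v\<^sub>0 \<in> V" and \<tau>: "strategy V E V\<^sub>1 \<tau>"
    and win: "\<And>\<rho>. play E \<rho> \<Longrightarrow> \<rho> 0 = v\<^sub>0 \<Longrightarrow> consistent V\<^sub>1 \<tau> \<rho> \<Longrightarrow>
      parity_wins True (\<lambda>k. col (\<rho> k, memory_at init upd \<rho> k))"
  shows "\<exists>nxt. next_move E V\<^sub>1 M nxt \<and>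
    (\<forall>\<rho>. play E \<rho> \<longrightarrow> \<rho> 0 = v\<^sub>0 \<longrightarrow>
      (\<forall>k. \<rho> k \<in> V\<^sub>1 \<longrightarrow> \<rho> (Suc k) = nxt (\<rho> k) (memory_at init upd \<rho> k)) \<longrightarrow>
      parity_wins True (\<lambda>k. col (\<rho> k, memory_at init upd \<rho> k)))"
proof -
  define F where "F = {((v, m), (v', m')). (v, v') \<in> E \<and> m' = upd m (v, v')}"
  interpret parity_game F "\<lambda>(v, m). v \<in> V\<^sub>1" col .
  have V1: "V\<^sub>1 \<subseteq> V" using arena.partition_union[OF A] by blast
  have EV: "E \<subseteq> V \<times> V" using arena.edges[OF A] .
  have "finite (V \<times> M)" using arena.finite_vertices[OF A] M by (simp add: memory_structure_def)
  moreover have "total_on (V \<times> M)"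
    unfolding total_on_def
  proof clarify
    fix v m assume "v \<in> V" "m \<in> M"
    moreover obtain v' where "(v, v') \<in> E" using arena.successor[OF A \<open>v \<in> V\<close>] by blast
    ultimately show "\<exists>t\<in>V \<times> M. ((v, m), t) \<in> F"
      using M EV by (intro bexI[of _ "(v', upd m (v, v'))"]) (auto simp: F_def memory_structure_def)
  qed
  ultimately obtain X \<sigma> \<sigma>' where X: "wins (V \<times> M) True \<sigma> X"
    and Y: "wins (V \<times> M) False \<sigma>' (V \<times> M - X)"
    using positional_determinacy[of "V \<times> M" True] by auto
  have "(v\<^sub>0, init v\<^sub>0) \<in> V \<times> M" using \<open>v\<^sub>0 \<in> V\<close> M by (simp add: memory_structure_def)
  have "(v\<^sub>0, init v\<^sub>0) \<in> X"
  proof (rule ccontr)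
    define Z where "Z = V \<times> M - X"
    assume "(v\<^sub>0, init v\<^sub>0) \<notin> X"
    then have init_Z: "(v\<^sub>0, init v\<^sub>0) \<in> Z" using \<open>(v\<^sub>0, init v\<^sub>0) \<in> V \<times> M\<close> by (simp add: Z_def)
    \<comment> \<open>\<open>h k\<close> is the history after \<open>k\<close> moves. Player 1
      applies \<tau> to the history; Player 0 applies \<sigma>' to the product position that the
      history determines, and only the vertex of the result is kept.\<close>
    define h where "h = rec_nat [v\<^sub>0] (\<lambda>_ l. l @
      [if last l \<in> V\<^sub>1 then \<tau> l else fst (\<sigma>' (last l, upd_plus init upd l))])"
    define \<rho> where "\<rho> k = last (h k)" for k
    have h0: "h 0 = [v\<^sub>0]" by (simp add: h_def)
    have hSuc: "h (Suc k) = h k @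
      [if \<rho> k \<in> V\<^sub>1 then \<tau> (h k) else fst (\<sigma>' (\<rho> k, upd_plus init upd (h k)))]" for k
      by (simp add: h_def \<rho>_def)
    have h: "map \<rho> [0..<Suc k] = h k" for k
    proof (induction k)
      case (Suc k)
      then show ?case using hSuc[of k] by (simp add: \<rho>_def)
    qed (simp add: \<rho>_def h0)
    define m where "m = memory_at init upd \<rho>"
    have \<rho>Suc: "\<rho> (Suc k) = (if \<rho> k \<in> V\<^sub>1 then \<tau> (h k) else fst (\<sigma>' (\<rho> k, m k)))" for k
      using hSuc[of k] by (simp add: \<rho>_def m_def memory_at_def h del: upt_Suc)
    have inv: "set (h k) \<subseteq> V \<and> (\<rho> k, m k) \<in> Z \<and> (\<rho> k, \<rho> (Suc k)) \<in> E \<and>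
      ((\<rho> k, m k), (\<rho> (Suc k), m (Suc k))) \<in> F \<and> (\<rho> (Suc k), m (Suc k)) \<in> Z \<and>
      (\<rho> k \<notin> V\<^sub>1 \<longrightarrow> (\<rho> (Suc k), m (Suc k)) = \<sigma>' (\<rho> k, m k))" for k
    proof -
      have step: "(\<rho> k, \<rho> (Suc k)) \<in> E \<and>
        ((\<rho> k, m k), (\<rho> (Suc k), m (Suc k))) \<in> F \<and> (\<rho> (Suc k), m (Suc k)) \<in> Z \<and>
        (\<rho> k \<notin> V\<^sub>1 \<longrightarrow> (\<rho> (Suc k), m (Suc k)) = \<sigma>' (\<rho> k, m k))"
        if hV: "set (h k) \<subseteq> V" and Z: "(\<rho> k, m k) \<in> Z" for k
      proof (cases "\<rho> k \<in> V\<^sub>1")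
        case True
        have "h k = map \<rho> [0..<k] @ [\<rho> k]" using h[of k] by simp
        moreover have "set (map \<rho> [0..<k]) \<subseteq> V" using hV unfolding \<open>h k = _\<close> by simp
        ultimately have e: "(\<rho> k, \<rho> (Suc k)) \<in> E"
          using \<tau> True unfolding strategy_def \<rho>Suc by simp
        then have F': "((\<rho> k, m k), (\<rho> (Suc k), m (Suc k))) \<in> F"
          by (simp add: F_def m_def memory_at_Suc)
        moreover have "(\<rho> (Suc k), m (Suc k)) \<in> V \<times> M"
          using e EV Z M by (auto simp: Z_def m_def memory_at_Suc memory_structure_def)
        ultimately have "(\<rho> (Suc k), m (Suc k)) \<in> Z"
          using Y Z True unfolding wins_def Z_def by blast
        then show ?thesis using e F' True by simp
      next
        case False
        then have Z': "\<sigma>' (\<rho> k, m k) \<in> Z" and F': "((\<rho> k, m k), \<sigma>' (\<rho> k, m k)) \<in> F"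
          using Y Z unfolding wins_def Z_def by auto
        moreover obtain v' m' where vm: "\<sigma>' (\<rho> k, m k) = (v', m')" by fastforce
        ultimately have "v' = \<rho> (Suc k)" "m' = m (Suc k)" "(\<rho> k, v') \<in> E"
          using False by (auto simp: F_def \<rho>Suc[of k] m_def memory_at_Suc)
        then show ?thesis using Z' F' vm by simp
      qed
      have "set (h k) \<subseteq> V \<and> (\<rho> k, m k) \<in> Z"
      proof (induction k)
        case 0
        then show ?case using init_Z \<open>v\<^sub>0 \<in> V\<close> by (simp add: h0 m_def memory_at_0 \<rho>_def)
      next
        case (Suc k)
        then have "(\<rho> (Suc k), m (Suc k)) \<in> Z" using step by blast
        moreover from this have "\<rho> (Suc k) \<in> V" by (simp add: Z_def)
        moreover have "h (Suc k) = h k @ [\<rho> (Suc k)]" by (simp add: h[symmetric])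
        ultimately show ?case using Suc by simp
      qed
      with step show ?thesis by blast
    qed
    have "positional_play False \<sigma>' Z (\<lambda>k. (\<rho> k, m k))"
      using inv by (simp add: positional_play_def)
    then have "parity_wins False (\<lambda>k. col (\<rho> k, m k))"
      using Y unfolding wins_def Z_def by blast
    moreover have "consistent V\<^sub>1 \<tau> \<rho>"
      unfolding consistent_def h using \<rho>Suc by simp
    then have "parity_wins True (\<lambda>k. col (\<rho> k, m k))"
      using win[of \<rho>] inv by (simp add: play_def m_def) (simp add: \<rho>_def h0)
    ultimately show False using parity_wins_unique by blast
  qed
  obtain sc where sc: "\<And>v. v \<in> V\<^sub>1 \<Longrightarrow> (v, sc v) \<in> E"
    using arena.successor[OF A] V1 by (metis subsetD)
  \<comment> \<open>Plays from the initial position never leave \<open>X\<close>; the default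
    \<open>sc\<close> only ensures legal moves in the other product positions.\<close>
  define nxt where "nxt v m = (if (v, m) \<in> X then fst (\<sigma> (v, m)) else sc v)" for v m
  have \<sigma>: "(\<exists>v'. \<sigma> (v, m) = (v', upd m (v, v')) \<and> (v, v') \<in> E) \<and> \<sigma> (v, m) \<in> X"
    if "(v, m) \<in> X" "v \<in> V\<^sub>1" for v m
  proof -
    have "\<sigma> (v, m) \<in> X \<and> ((v, m), \<sigma> (v, m)) \<in> F" using X that unfolding wins_def by auto
    then show ?thesis by (auto simp: F_def)
  qed
  have "next_move E V\<^sub>1 M nxt"
    unfolding next_move_def
  proof (intro ballI)
    fix v m assume "v \<in> V\<^sub>1" "m \<in> M"
    then show "(v, nxt v m) \<in> E" using \<sigma>[of v m] sc by (auto simp: nxt_def)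
  qed
  moreover have "parity_wins True (\<lambda>k. col (\<rho> k, memory_at init upd \<rho> k))"
    if "play E \<rho>" "\<rho> 0 = v\<^sub>0"
      "\<forall>k. \<rho> k \<in> V\<^sub>1 \<longrightarrow> \<rho> (Suc k) = nxt (\<rho> k) (memory_at init upd \<rho> k)" for \<rho>
  proof -
    define m where "m = memory_at init upd \<rho>"
    have F: "((\<rho> k, m k), (\<rho> (Suc k), m (Suc k))) \<in> F" for k
      using that(1) by (simp add: F_def m_def memory_at_Suc play_def)
    have VM: "(\<rho> k, m k) \<in> V \<times> M" for k
      using play_in_vertices[OF A that(1)] memory_at_in[OF A M that(1)] by (simp add: m_def)
    have strat: "(\<rho> (Suc k), m (Suc k)) = \<sigma> (\<rho> k, m k)" if "(\<rho> k, m k) \<in> X" "\<rho> k \<in> V\<^sub>1" for k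
      using \<sigma>[OF that] that \<open>\<forall>k. _\<close> by (auto simp: nxt_def m_def memory_at_Suc)
    have inX: "(\<rho> k, m k) \<in> X" for k
    proof (induction k)
      case 0
      then show ?case using \<open>(v\<^sub>0, init v\<^sub>0) \<in> X\<close> that(2) by (simp add: m_def memory_at_0)
    next
      case (Suc k)
      show ?case
      proof (cases "\<rho> k \<in> V\<^sub>1")
        case True
        then show ?thesis using \<sigma>[OF Suc True] strat[OF Suc True] by simp
      next
        case False
        then show ?thesis using X Suc F VM[of "Suc k"] unfolding wins_def by blast
      qed
    qed
    have "positional_play True \<sigma> X (\<lambda>k. (\<rho> k, m k))"
      using inX strat F by (simp add: positional_play_def)
    then show ?thesis using X unfolding wins_def m_def by blast
  qed
  ultimately show ?thesis by blast
qed


section \<open>Tracking the weights of open requests\<close>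

definition weight_upto :: "('v \<times> 'v \<Rightarrow> int) \<Rightarrow> (nat \<Rightarrow> 'v) \<Rightarrow> nat \<Rightarrow> int" where
  "weight_upto w \<rho> k = (\<Sum>i<k. w (\<rho> i, \<rho> (Suc i)))"

lemma path_weight_infix:
  assumes "j \<le> k"
  shows "path_weight w (map \<rho> [j..<Suc k]) = weight_upto w \<rho> k - weight_upto w \<rho> j"
proof -
  have "zip (map \<rho> [j..<Suc k]) (tl (map \<rho> [j..<Suc k])) = map (\<lambda>i. (\<rho> i, \<rho> (Suc i))) [j..<k]"
    by (rule nth_equalityI) (auto simp: nth_tl simp del: upt_Suc)
  then have "path_weight w (map \<rho> [j..<Suc k]) = (\<Sum>i = j..<k. w (\<rho> i, \<rho> (Suc i)))"
    by (simp add: path_weight_def interv_sum_list_conv_sum_set_nat comp_def del: upt_Suc)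
  also have "\<dots> = weight_upto w \<rho> k - weight_upto w \<rho> j"
    using sum.atLeastLessThan_concat[of 0 j k "\<lambda>i. w (\<rho> i, \<rho> (Suc i))"] assms
    by (simp add: weight_upto_def lessThan_atLeast0)
  finally show ?thesis .
qed

text \<open>For \<open>b = Suc a\<close> the bound becomes the strict \<open>a < _\<close>, which a
  supremum satisfies iff some element does. For \<open>b = 0\<close> and empty \<open>A\<close> the
  equivalence fails.\<close>

lemma enat_le_SUP_iff:
  fixes f :: "'a \<Rightarrow> enat"
  assumes "b > 0"
  shows "enat b \<le> (SUP x\<in>A. f x) \<longleftrightarrow> (\<exists>x\<in>A. enat b \<le> f x)"
proof -
  obtain a where "b = Suc a" using assms gr0_implies_Suc by blast
  then show ?thesis by (simp add: Suc_ile_eq less_SUP_iff)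
qed

lemma enat_le_limsup_iff:
  fixes f :: "nat \<Rightarrow> enat"
  assumes "b > 0"
  shows "enat b \<le> limsup f \<longleftrightarrow> (\<exists>\<^sub>\<infinity>k. enat b \<le> f k)"
  using assms by (auto simp: limsup_INF_SUP le_INF_iff enat_le_SUP_iff INFM_nat_le)

lemma Ampl_infix_ge_iff:
  assumes "b > 0" "j \<le> j'"
  shows "enat b \<le> Ampl w (map \<rho> [j..<Suc j']) \<longleftrightarrow>
    (\<exists>k\<in>{j..j'}. int b \<le> \<bar>weight_upto w \<rho> k - weight_upto w \<rho> j\<bar>)"
proof -
  have take: "take (Suc t) (map \<rho> [j..<Suc j']) = map \<rho> [j..<Suc (j + t)]" if "t < Suc j' - j" for t
    using that by (simp add: take_map del: upt_Suc)
  have "enat b \<le> Ampl w (map \<rho> [j..<Suc j']) \<longleftrightarrow>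
      (\<exists>t<Suc j' - j. b \<le> nat \<bar>path_weight w (take (Suc t) (map \<rho> [j..<Suc j']))\<bar>)"
    using assms by (simp add: Ampl_def enat_le_SUP_iff Bex_def del: upt_Suc take_Suc)
  also have "\<dots> \<longleftrightarrow> (\<exists>t<Suc j' - j. int b \<le> \<bar>weight_upto w \<rho> (j + t) - weight_upto w \<rho> j\<bar>)"
    using take path_weight_infix[of j "j + _" w \<rho>] by (auto simp del: upt_Suc simp: le_nat_iff)
  also have "\<dots> \<longleftrightarrow> (\<exists>k\<in>{j..j'}. int b \<le> \<bar>weight_upto w \<rho> k - weight_upto w \<rho> j\<bar>)"
  proof
    assume "\<exists>k\<in>{j..j'}. int b \<le> \<bar>weight_upto w \<rho> k - weight_upto w \<rho> j\<bar>"
    then obtain k where "k \<in> {j..j'}" "int b \<le> \<bar>weight_upto w \<rho> k - weight_upto w \<rho> j\<bar>" by blast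
    then show "\<exists>t<Suc j' - j. int b \<le> \<bar>weight_upto w \<rho> (j + t) - weight_upto w \<rho> j\<bar>"
      by (intro exI[of _ "k - j"]) auto
  qed (use assms in force)
  finally show ?thesis .
qed

section \<open>Costly requests and the memory that tracks them\<close>

locale request_tracking =
  fixes \<Omega> :: "'v \<Rightarrow> nat" and w :: "'v \<times> 'v \<Rightarrow> int" and b :: nat
  assumes b_pos: "b > 0"
begin

text \<open>This is \<open>enat b \<le> Cor \<Omega> w \<rho> j\<close> without infima and suprema.
  A request that is never answered is costly vacuously.\<close>

definition costly :: "(nat \<Rightarrow> 'v) \<Rightarrow> nat \<Rightarrow> bool" where
  "costly \<rho> j \<longleftrightarrow> (\<forall>j'\<ge>j. \<Omega> (\<rho> j') \<in> Ans (\<Omega> (\<rho> j)) \<longrightarrow>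
     (\<exists>k\<in>{j..j'}. int b \<le> \<bar>weight_upto w \<rho> k - weight_upto w \<rho> j\<bar>))"

lemma limsup_Cor_ge_iff: "enat b \<le> limsup (Cor \<Omega> w \<rho>) \<longleftrightarrow> (\<exists>\<^sub>\<infinity>j. costly \<rho> j)"
proof -
  have "enat b \<le> Cor \<Omega> w \<rho> j \<longleftrightarrow> costly \<rho> j" for j
    unfolding Cor_def costly_def le_Inf_iff
    using Ampl_infix_ge_iff[OF b_pos, of j _ w \<rho>] by blast
  then show ?thesis by (simp add: enat_le_limsup_iff[OF b_pos])
qed

text \<open>A vertex of even color answers its own request at once, with amplitude 0.\<close>

lemma costly_odd: "costly \<rho> j \<Longrightarrow> odd (\<Omega> (\<rho> j))"
  using b_pos by (force simp: costly_def Ans_def)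

text \<open>For every color with an open request, the memory holds the least and the greatest weight
  accumulated since such a request.\<close>

definition visit :: "'v \<Rightarrow> (nat \<Rightarrow> (int \<times> int) option) \<Rightarrow> nat \<Rightarrow> (int \<times> int) option" where
  "visit v g = (\<lambda>c.
     if even (\<Omega> v) then if c \<le> \<Omega> v then None else g c
     else if c = \<Omega> v
       then Some (case g c of None \<Rightarrow> (0, 0) | Some (l, h) \<Rightarrow> (min l 0, max h 0))
       else g c)"

definition traverse :: "int \<Rightarrow> (nat \<Rightarrow> (int \<times> int) option) \<Rightarrow> nat \<Rightarrow> (int \<times> int) option" where
  "traverse x g = (\<lambda>c. map_option (\<lambda>(l, h). (l + x, h + x)) (g c))"

definition within_bound :: "(nat \<Rightarrow> (int \<times> int) option) \<Rightarrow> bool" where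
  "within_bound g \<longleftrightarrow> (\<forall>c l h. g c = Some (l, h) \<longrightarrow> - int b < l \<and> h < int b)"

text \<open>The memory state \<open>None\<close> signals that some open request has just reached amplitude \<open>b\<close>;
  all requests but the one of the current vertex are then forgotten.\<close>

definition tracked :: "'v \<Rightarrow> (nat \<Rightarrow> (int \<times> int) option) option \<Rightarrow> nat \<Rightarrow> (int \<times> int) option" where
  "tracked v m = (case m of None \<Rightarrow> visit v (\<lambda>_. None) | Some g \<Rightarrow> g)"

definition track_init :: "'v \<Rightarrow> (nat \<Rightarrow> (int \<times> int) option) option" where
  "track_init v = Some (visit v (\<lambda>_. None))"

definition track_upd ::
  "(nat \<Rightarrow> (int \<times> int) option) option \<Rightarrow> 'v \<times> 'v \<Rightarrow> (nat \<Rightarrow> (int \<times> int) option) option" where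
  "track_upd m e = (let g = traverse (w e) (tracked (fst e) m)
     in if within_bound g then Some (visit (snd e) g) else None)"

abbreviation track :: "(nat \<Rightarrow> 'v) \<Rightarrow> nat \<Rightarrow> (nat \<Rightarrow> (int \<times> int) option) option" where
  "track \<equiv> memory_at track_init track_upd"

text \<open>\<open>D c\<close> is the set of weights accumulated by the open requests of color
  \<open>c\<close>, of which \<open>g\<close> keeps the extremes. They suffice because requests of
  equal color are shifted by the same edge weights and answered simultaneously.\<close>

definition represents :: "(nat \<Rightarrow> int set) \<Rightarrow> (nat \<Rightarrow> (int \<times> int) option) \<Rightarrow> bool" where
  "represents D g \<longleftrightarrow> (\<forall>c. case g c of None \<Rightarrow> D c = {}
     | Some (l, h) \<Rightarrow> l \<in> D c \<and> h \<in> D c \<and> D c \<subseteq> {l..h})"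

lemma represents_traverse: "represents D g \<Longrightarrow> represents (\<lambda>c. (+) x ` D c) (traverse x g)"
  unfolding represents_def traverse_def
  by (intro allI) (drule spec, fastforce split: option.splits)

lemma represents_visit:
  assumes "represents D g"
  shows "represents
    (\<lambda>c. if even (\<Omega> v) \<and> c \<le> \<Omega> v then {} else D c \<union> (if c = \<Omega> v then {0} else {})) (visit v g)"
  unfolding represents_def
proof
  fix c
  have "case g c of None \<Rightarrow> D c = {} | Some (l, h) \<Rightarrow> l \<in> D c \<and> h \<in> D c \<and> D c \<subseteq> {l..h}"
    using assms by (simp add: represents_def)
  then show "case visit v g c of
      None \<Rightarrow> (if even (\<Omega> v) \<and> c \<le> \<Omega> v then {} else D c \<union> (if c = \<Omega> v then {0} else {})) = {}
    | Some (l, h) \<Rightarrow>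
        l \<in> (if even (\<Omega> v) \<and> c \<le> \<Omega> v then {} else D c \<union> (if c = \<Omega> v then {0} else {})) \<and>
        h \<in> (if even (\<Omega> v) \<and> c \<le> \<Omega> v then {} else D c \<union> (if c = \<Omega> v then {0} else {})) \<and>
        (if even (\<Omega> v) \<and> c \<le> \<Omega> v then {} else D c \<union> (if c = \<Omega> v then {0} else {})) \<subseteq> {l..h}"
    by (auto simp: visit_def min_def max_def split: option.splits)
qed

text \<open>The recorded extremes belong to \<open>D c\<close> and enclose it, so it is enough to
  test \<open>l\<close> from below and \<open>h\<close> from above.\<close>

lemma not_within_bound_iff:
  assumes "represents D g"
  shows "\<not> within_bound g \<longleftrightarrow> (\<exists>c. \<exists>x\<in>D c. int b \<le> \<bar>x\<bar>)"
proof
  assume "\<not> within_bound g"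
  then obtain c l h where g: "g c = Some (l, h)" and "l \<le> - int b \<or> int b \<le> h"
    by (auto simp: within_bound_def not_less)
  moreover have "l \<in> D c" "h \<in> D c"
    using assms[unfolded represents_def, rule_format, of c] g by auto
  moreover have "int b \<le> \<bar>l\<bar> \<or> int b \<le> \<bar>h\<bar>" using \<open>l \<le> - int b \<or> int b \<le> h\<close> by linarith
  ultimately show "\<exists>c. \<exists>x\<in>D c. int b \<le> \<bar>x\<bar>" by blast
next
  assume "\<exists>c. \<exists>x\<in>D c. int b \<le> \<bar>x\<bar>"
  then obtain c x where x: "x \<in> D c" "int b \<le> \<bar>x\<bar>" by blast
  with assms[unfolded represents_def, rule_format, of c]
  obtain l h where "g c = Some (l, h)" "x \<in> {l..h}" by (auto split: option.splits)
  with x show "\<not> within_bound g" by (force simp: within_bound_def)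
qed

section \<open>Overflows and open requests\<close>

definition unanswered :: "(nat \<Rightarrow> 'v) \<Rightarrow> nat \<Rightarrow> nat \<Rightarrow> bool" where
  "unanswered \<rho> j k \<longleftrightarrow> (\<forall>i\<in>{j..k}. \<Omega> (\<rho> i) \<notin> Ans (\<Omega> (\<rho> j)))"

text \<open>The sets that the memory represents. Here \<open>s\<close> will be the position of the
  latest overflow, or 0; requests before \<open>s\<close> are forgotten.\<close>

definition open_weights :: "(nat \<Rightarrow> 'v) \<Rightarrow> nat \<Rightarrow> nat \<Rightarrow> nat \<Rightarrow> int set" where
  "open_weights \<rho> s k c = {weight_upto w \<rho> k - weight_upto w \<rho> j | j.
     j \<in> {s..k} \<and> \<Omega> (\<rho> j) = c \<and> unanswered \<rho> j k}"

text \<open>The union with the empty set makes the right-hand side an instance of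
  \<open>represents_visit\<close> for empty \<open>D\<close>.\<close>

lemma open_weights_refl:
  "open_weights \<rho> s s = (\<lambda>c. if even (\<Omega> (\<rho> s)) \<and> c \<le> \<Omega> (\<rho> s) then {}
     else {} \<union> (if c = \<Omega> (\<rho> s) then {0} else {}))"
  by (auto simp: open_weights_def unanswered_def Ans_def fun_eq_iff)

text \<open>The right-hand side is the effect of \<open>represents_traverse\<close> followed by that
  of \<open>represents_visit\<close>: old requests are shifted, then the new vertex answers requests
  or opens one.\<close>

lemma open_weights_Suc:
  assumes "s \<le> k"
  shows "open_weights \<rho> s (Suc k) = (\<lambda>c. if even (\<Omega> (\<rho> (Suc k))) \<and> c \<le> \<Omega> (\<rho> (Suc k)) then {}
     else (+) (w (\<rho> k, \<rho> (Suc k))) ` open_weights \<rho> s k c \<union>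
       (if c = \<Omega> (\<rho> (Suc k)) then {0} else {}))"
proof
  fix c
  have una: "unanswered \<rho> j (Suc k) \<longleftrightarrow>
      unanswered \<rho> j k \<and> \<not> (even (\<Omega> (\<rho> (Suc k))) \<and> \<Omega> (\<rho> j) \<le> \<Omega> (\<rho> (Suc k)))" if "j \<le> Suc k" for j
    using that by (auto simp: unanswered_def Ans_def le_Suc_eq)
  have self: "unanswered \<rho> (Suc k) (Suc k) \<longleftrightarrow> odd (\<Omega> (\<rho> (Suc k)))"
    by (auto simp: unanswered_def Ans_def)
  have wt: "weight_upto w \<rho> (Suc k) = weight_upto w \<rho> k + w (\<rho> k, \<rho> (Suc k))"
    by (simp add: weight_upto_def)
  show "open_weights \<rho> s (Suc k) c = (if even (\<Omega> (\<rho> (Suc k))) \<and> c \<le> \<Omega> (\<rho> (Suc k)) then {}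
     else (+) (w (\<rho> k, \<rho> (Suc k))) ` open_weights \<rho> s k c \<union>
       (if c = \<Omega> (\<rho> (Suc k)) then {0} else {}))" (is "?L = ?R")
  proof (intro set_eqI iffI)
    fix x assume "x \<in> ?L"
    then obtain j where j: "x = weight_upto w \<rho> (Suc k) - weight_upto w \<rho> j" "s \<le> j" "j \<le> Suc k"
      "\<Omega> (\<rho> j) = c" "unanswered \<rho> j (Suc k)" by (auto simp: open_weights_def)
    show "x \<in> ?R"
    proof (cases "j = Suc k")
      case False
      then have "weight_upto w \<rho> k - weight_upto w \<rho> j \<in> open_weights \<rho> s k c"
        using j una[of j] by (auto simp: open_weights_def)
      moreover have "x = w (\<rho> k, \<rho> (Suc k)) + (weight_upto w \<rho> k - weight_upto w \<rho> j)"
        using j wt by simp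
      ultimately show ?thesis using j una[of j] by auto
    qed (use j self in auto)
  next
    fix x assume R: "x \<in> ?R"
    then have c: "\<not> (even (\<Omega> (\<rho> (Suc k))) \<and> c \<le> \<Omega> (\<rho> (Suc k)))" by (auto split: if_splits)
    consider y where "y \<in> open_weights \<rho> s k c" "x = w (\<rho> k, \<rho> (Suc k)) + y"
      | "c = \<Omega> (\<rho> (Suc k))" "x = 0"
      using R by (auto split: if_splits)
    then show "x \<in> ?L"
    proof cases
      case 1
      then obtain j where "y = weight_upto w \<rho> k - weight_upto w \<rho> j" "s \<le> j" "j \<le> k"
        "\<Omega> (\<rho> j) = c" "unanswered \<rho> j k" by (auto simp: open_weights_def)
      then show ?thesis
        unfolding open_weights_def using 1 c una[of j] wt by (intro CollectI exI[of _ j]) auto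
    next
      case 2
      then show ?thesis
        unfolding open_weights_def using c self assms by (intro CollectI exI[of _ "Suc k"]) auto
    qed
  qed
qed

text \<open>At position \<open>s\<close> the tracked ranges are those of a fresh visit, both at the
  start and after an overflow. From there each step without overflow is a traversal followed by a
  visit.\<close>

lemma tracked_represents:
  assumes "s = 0 \<or> track \<rho> s = None" "s \<le> k" "\<And>t. s < t \<Longrightarrow> t \<le> k \<Longrightarrow> track \<rho> t \<noteq> None"
  shows "represents (open_weights \<rho> s k) (tracked (\<rho> k) (track \<rho> k))"
  using assms(2,3)
proof (induction k rule: dec_induct)
  case base
  have "tracked (\<rho> s) (track \<rho> s) = visit (\<rho> s) (\<lambda>_. None)"
    using assms(1) by (auto simp: tracked_def memory_at_0 track_init_def)
  moreover have "represents (\<lambda>_. {}) (\<lambda>_. None)" by (simp add: represents_def)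
  ultimately show ?case unfolding open_weights_refl by (simp only: represents_visit)
next
  case (step k)
  have "track \<rho> (Suc k) \<noteq> None" using step by simp
  then have "tracked (\<rho> (Suc k)) (track \<rho> (Suc k)) =
      visit (\<rho> (Suc k)) (traverse (w (\<rho> k, \<rho> (Suc k))) (tracked (\<rho> k) (track \<rho> k)))"
    by (auto simp: memory_at_Suc track_upd_def tracked_def Let_def split: if_splits)
  moreover have "represents (open_weights \<rho> s k) (tracked (\<rho> k) (track \<rho> k))"
    using step by simp
  ultimately show ?case
    unfolding open_weights_Suc[OF step.hyps(1)] by (simp only: represents_visit represents_traverse)
qed

text \<open>The bound is tested after traversing the edge but before visiting its target. A request
  thus counts even if vertex \<open>Suc k\<close> answers it, just as the amplitude includes the
  weight at the answer.\<close>

lemma track_overflow_iff: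
  assumes "s = 0 \<or> track \<rho> s = None" "s \<le> k" "\<And>t. s < t \<Longrightarrow> t \<le> k \<Longrightarrow> track \<rho> t \<noteq> None"
  shows "track \<rho> (Suc k) = None \<longleftrightarrow> (\<exists>j\<in>{s..k}. unanswered \<rho> j k \<and>
    int b \<le> \<bar>weight_upto w \<rho> (Suc k) - weight_upto w \<rho> j\<bar>)"
proof -
  let ?g = "traverse (w (\<rho> k, \<rho> (Suc k))) (tracked (\<rho> k) (track \<rho> k))"
  have "track \<rho> (Suc k) = None \<longleftrightarrow> \<not> within_bound ?g"
    by (simp add: memory_at_Suc track_upd_def Let_def)
  also have "\<dots> \<longleftrightarrow> (\<exists>c. \<exists>x\<in>(+) (w (\<rho> k, \<rho> (Suc k))) ` open_weights \<rho> s k c. int b \<le> \<bar>x\<bar>)"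
    by (rule not_within_bound_iff[OF represents_traverse[OF tracked_represents[OF assms]]])
  also have "\<dots> \<longleftrightarrow> (\<exists>j\<in>{s..k}. unanswered \<rho> j k \<and>
      int b \<le> \<bar>w (\<rho> k, \<rho> (Suc k)) + (weight_upto w \<rho> k - weight_upto w \<rho> j)\<bar>)"
    unfolding open_weights_def by blast
  also have "\<dots> \<longleftrightarrow> (\<exists>j\<in>{s..k}. unanswered \<rho> j k \<and>
      int b \<le> \<bar>weight_upto w \<rho> (Suc k) - weight_upto w \<rho> j\<bar>)"
    by (simp add: weight_upto_def algebra_simps)
  finally show ?thesis .
qed

text \<open>With \<open>K\<close> an upper bound of all colors, overflows get an odd color that
  dominates the others.\<close>

definition track_color :: "nat \<Rightarrow> 'v \<times> (nat \<Rightarrow> (int \<times> int) option) option \<Rightarrow> nat" where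
  "track_color K s = (if snd s = None then Suc (2 * K) else \<Omega> (fst s))"

text \<open>Take an overflow \<open>s\<close> beyond \<open>m\<close> and the next overflow
  \<open>t\<close>. The request that causes the latter was opened at or after \<open>s\<close> and
  is unanswered before \<open>t\<close>, so it is costly.\<close>

lemma overflow_costly:
  assumes "\<exists>\<^sub>\<infinity>k. track \<rho> k = None"
  shows "\<exists>\<^sub>\<infinity>j. costly \<rho> j"
  unfolding INFM_nat_le
proof
  fix m
  obtain s where s: "s \<ge> m" "track \<rho> s = None" using assms by (auto simp: INFM_nat_le)
  define t where "t = (LEAST t. t > s \<and> track \<rho> t = None)"
  have "\<exists>t>s. track \<rho> t = None" using assms by (auto simp: INFM_nat)
  then have t: "t > s" "track \<rho> t = None" unfolding t_def by (metis (mono_tags, lifting) LeastI_ex)+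
  have least: "track \<rho> t' \<noteq> None" if "s < t'" "t' < t" for t'
    using that not_less_Least[of t' "\<lambda>t. t > s \<and> track \<rho> t = None"] by (auto simp: t_def)
  obtain k where k: "t = Suc k" using t gr0_implies_Suc[of t] by auto
  have "s \<le> k" using t k by simp
  have "\<And>t'. s < t' \<Longrightarrow> t' \<le> k \<Longrightarrow> track \<rho> t' \<noteq> None" using least k by simp
  from track_overflow_iff[OF disjI2[OF s(2)] \<open>s \<le> k\<close> this] t(2) k
  obtain j where j: "s \<le> j" "j \<le> k" "unanswered \<rho> j k"
    "int b \<le> \<bar>weight_upto w \<rho> t - weight_upto w \<rho> j\<bar>" by auto
  have "costly \<rho> j"
    unfolding costly_def
  proof (intro allI impI)
    fix j' assume "j \<le> j'" "\<Omega> (\<rho> j') \<in> Ans (\<Omega> (\<rho> j))"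
    then have "t \<le> j'" using j(3) k by (force simp: unanswered_def)
    then show "\<exists>k\<in>{j..j'}. int b \<le> \<bar>weight_upto w \<rho> k - weight_upto w \<rho> j\<bar>"
      using j k by (intro bexI[of _ t]) auto
  qed
  then show "\<exists>j\<ge>m. costly \<rho> j" using j s by (meson le_trans)
qed

text \<open>Infinitely many overflows make both sides true. Otherwise the greatest color seen
  infinitely often decides: if it is odd, its late requests are never answered; if it is even, all
  late requests are answered, and a costly one among them would cause another overflow.\<close>

lemma costly_iff_parity_wins:
  assumes K: "\<And>k. \<Omega> (\<rho> k) \<le> K"
  shows "(\<exists>\<^sub>\<infinity>j. costly \<rho> j) \<longleftrightarrow> parity_wins True (\<lambda>k. track_color K (\<rho> k, track \<rho> k))"
proof
  assume "parity_wins True (\<lambda>k. track_color K (\<rho> k, track \<rho> k))"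
  then obtain c n where c: "odd c" "\<exists>\<^sub>\<infinity>k. track_color K (\<rho> k, track \<rho> k) = c"
    and n: "\<And>k. k \<ge> n \<Longrightarrow> track_color K (\<rho> k, track \<rho> k) \<le> c"
    by (auto simp: parity_wins_def MOST_nat_le)
  show "\<exists>\<^sub>\<infinity>j. costly \<rho> j"
  proof (cases "\<exists>\<^sub>\<infinity>k. track \<rho> k = None")
    case True
    then show ?thesis by (rule overflow_costly)
  next
    case False
    then have "\<forall>\<^sub>\<infinity>k. track \<rho> k \<noteq> None" by (simp add: not_INFM)
    then have "\<exists>\<^sub>\<infinity>k. track_color K (\<rho> k, track \<rho> k) = c \<and> track \<rho> k \<noteq> None"
      using c(2) by (simp add: INFM_conjI MOST_conj_distrib)
    show ?thesis
      unfolding INFM_nat_le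
    proof
      fix m
      obtain j where j: "j \<ge> max m n" "track_color K (\<rho> j, track \<rho> j) = c" "track \<rho> j \<noteq> None"
        using \<open>\<exists>\<^sub>\<infinity>k. _ \<and> _\<close> unfolding INFM_nat_le by blast
      then have "\<Omega> (\<rho> j) = c" by (simp add: track_color_def)
      have "\<Omega> (\<rho> j') \<notin> Ans c" if "j' \<ge> j" for j'
      proof -
        have "\<Omega> (\<rho> j') \<le> track_color K (\<rho> j', track \<rho> j')"
          using K[of j'] by (simp add: track_color_def)
        also have "\<dots> \<le> c" using n j that by simp
        finally show ?thesis using \<open>odd c\<close> by (auto simp: Ans_def)
      qed
      then show "\<exists>j\<ge>m. costly \<rho> j" using j \<open>\<Omega> (\<rho> j) = c\<close> by (auto simp: costly_def)
    qed
  qed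
next
  assume costly: "\<exists>\<^sub>\<infinity>j. costly \<rho> j"
  show "parity_wins True (\<lambda>k. track_color K (\<rho> k, track \<rho> k))"
  proof (cases "\<exists>\<^sub>\<infinity>k. track \<rho> k = None")
    case True
    then have "\<exists>\<^sub>\<infinity>k. track_color K (\<rho> k, track \<rho> k) = Suc (2 * K)"
      by (rule INFM_mono) (simp add: track_color_def)
    moreover have "track_color K (\<rho> k, track \<rho> k) \<le> Suc (2 * K)" for k
      using K[of k] by (simp add: track_color_def)
    ultimately show ?thesis
      unfolding parity_wins_def by (intro exI[of _ "Suc (2 * K)"]) simp
  next
    case False
    then have no_ov: "\<forall>\<^sub>\<infinity>k. track \<rho> k \<noteq> None" by (simp add: not_INFM)
    then have "finite {k. track \<rho> k = None}" by (simp add: MOST_iff_finiteNeg)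
    \<comment> \<open>\<open>s\<close> is the last overflow, or 0 if there is none.\<close>
    then obtain s where s: "s = 0 \<or> track \<rho> s = None" and Some: "\<And>t. t > s \<Longrightarrow> track \<rho> t \<noteq> None"
    proof (cases "{k. track \<rho> k = None} = {}")
      case False
      with \<open>finite _\<close> that[of "Max {k. track \<rho> k = None}"] show thesis
        using Max_in[of "{k. track \<rho> k = None}"] Max_ge[of "{k. track \<rho> k = None}"]
        by (metis (mono_tags, lifting) mem_Collect_eq not_less)
    qed (use that[of 0] in auto)
    obtain c where c: "\<exists>\<^sub>\<infinity>k. \<Omega> (\<rho> k) = c" "\<forall>\<^sub>\<infinity>k. \<Omega> (\<rho> k) \<le> c"
      using limsup_color[of "\<lambda>k. \<Omega> (\<rho> k)" K] K by blast
    have "odd c"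
    proof
      assume "even c"
      obtain n where n: "\<And>k. k \<ge> n \<Longrightarrow> \<Omega> (\<rho> k) \<le> c" using c(2) by (auto simp: MOST_nat_le)
      obtain j where j: "j \<ge> max n s" "costly \<rho> j" using costly unfolding INFM_nat_le by blast
      obtain a where "a \<ge> j" "\<Omega> (\<rho> a) = c" using c(1) by (auto simp: INFM_nat_le)
      then have ex: "\<exists>a. a \<ge> j \<and> \<Omega> (\<rho> a) \<in> Ans (\<Omega> (\<rho> j))"
        using n[of j] j \<open>even c\<close> by (auto simp: Ans_def)
      \<comment> \<open>At the first answer \<open>j'\<close> at the latest, the costly request has
        reached amplitude \<open>b\<close>. One position before it does so it is still open, so the
        memory overflows at \<open>k\<close>, after the last overflow.\<close>
      define j' where "j' = (LEAST a. a \<ge> j \<and> \<Omega> (\<rho> a) \<in> Ans (\<Omega> (\<rho> j)))"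
      have j': "j' \<ge> j" "\<Omega> (\<rho> j') \<in> Ans (\<Omega> (\<rho> j))"
        using LeastI_ex[OF ex] by (auto simp: j'_def)
      obtain k where k: "j \<le> k" "k \<le> j'" "int b \<le> \<bar>weight_upto w \<rho> k - weight_upto w \<rho> j\<bar>"
        using j(2) j' unfolding costly_def by (meson atLeastAtMost_iff)
      then have "k \<noteq> j" using b_pos by auto
      then obtain l where l: "k = Suc l" "j \<le> l" using k(1) by (cases k) auto
      have "unanswered \<rho> j l"
        using not_less_Least[of _ "\<lambda>a. a \<ge> j \<and> \<Omega> (\<rho> a) \<in> Ans (\<Omega> (\<rho> j))"] k(2) l
        by (auto simp: unanswered_def j'_def[symmetric])
      moreover have "s \<le> l" using j l by simp
      ultimately have "track \<rho> k = None"
        using track_overflow_iff[OF s \<open>s \<le> l\<close> Some] j l k(3) by auto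
      then show False using Some[of k] j l by simp
    qed
    moreover have "\<exists>\<^sub>\<infinity>k. track_color K (\<rho> k, track \<rho> k) = c"
      using INFM_conjI[OF c(1) no_ov] by (rule INFM_mono) (auto simp: track_color_def)
    moreover have "\<forall>\<^sub>\<infinity>k. track_color K (\<rho> k, track \<rho> k) \<le> c"
      using c(2) no_ov by eventually_elim (auto simp: track_color_def)
    ultimately show ?thesis unfolding parity_wins_def by auto
  qed
qed

section \<open>Size of the memory\<close>

definition bounds :: "(int \<times> int) option set" where
  "bounds = insert None (Some ` {(l, h). - int b < l \<and> l \<le> h \<and> h < int b})"

definition track_states :: "nat set \<Rightarrow> (nat \<Rightarrow> (int \<times> int) option) option set" where
  "track_states C = insert None (Some ` {g. \<forall>c. g c \<in> (if c \<in> C then bounds else {None})})"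

text \<open>For each upper end \<open>h\<close> there are \<open>h + b\<close> lower ends, which
  sums to 1 + 2 + ... + (2b - 1); \<open>None\<close> adds one more.\<close>

lemma bounds_card: "finite bounds" "card bounds = Suc (b * (2 * b - 1))"
proof -
  let ?P = "{(l, h). - int b < l \<and> l \<le> h \<and> h < int b}"
  have P: "?P = prod.swap ` (SIGMA h:{- int b<..<int b}. {- int b<..h})" by force
  have "card ?P = (\<Sum>h\<in>{- int b<..<int b}. nat (h + int b))"
    unfolding P by (simp add: card_image card_SigmaI)
  also have "\<dots> = \<Sum>{1..<2 * b}"
    by (rule sum.reindex_bij_witness[of _ "\<lambda>i. int i - int b" "\<lambda>h. nat (h + int b)"]) auto
  also have "{1..<2 * b} = {1..2 * b - 1}" using b_pos by auto
  also have "\<Sum>{1..2 * b - 1} = b * (2 * b - 1)"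
    using gauss_sum_from_Suc_0[of "2 * b - 1", where 'a = nat] b_pos by simp
  finally have card: "card ?P = b * (2 * b - 1)" .
  have fin: "finite ?P" unfolding P by simp
  then show "finite bounds" by (simp add: bounds_def)
  have "card (Some ` ?P) = b * (2 * b - 1)" using card by (simp add: card_image)
  with fin show "card bounds = Suc (b * (2 * b - 1))"
    unfolding bounds_def by (subst card_insert_disjoint) auto
qed

text \<open>A tracking function is \<open>None\<close> outside \<open>C\<close> and hence determined
  by its restriction to \<open>C\<close>. The outer \<open>Suc\<close> counts the overflow
  state.\<close>

lemma track_states_card:
  assumes "finite C"
  shows "finite (track_states C)" "card (track_states C) \<le> Suc (Suc (b * (2 * b - 1)) ^ card C)"
proof -
  define G where "G = {g. \<forall>c. g c \<in> (if c \<in> C then bounds else {None})}"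
  have G: "G \<subseteq> (\<lambda>g c. if c \<in> C then g c else None) ` (C \<rightarrow>\<^sub>E bounds)"
  proof
    fix g assume "g \<in> G"
    then have g: "g c \<in> (if c \<in> C then bounds else {None})" for c by (simp add: G_def)
    have "g c \<in> bounds" if "c \<in> C" for c using g[of c] that by simp
    then have "restrict g C \<in> C \<rightarrow>\<^sub>E bounds" by simp
    moreover have "g c = (if c \<in> C then restrict g C c else None)" for c
      using g[of c] by (simp split: if_splits)
    ultimately show "g \<in> (\<lambda>g c. if c \<in> C then g c else None) ` (C \<rightarrow>\<^sub>E bounds)" by blast
  qed
  have fin: "finite (C \<rightarrow>\<^sub>E bounds)" using assms bounds_card by (simp add: finite_PiE)
  then have "card G \<le> card (C \<rightarrow>\<^sub>E bounds)" by (rule surj_card_le[OF _ G])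
  also have "\<dots> = Suc (b * (2 * b - 1)) ^ card C" using assms bounds_card by (simp add: card_PiE)
  finally have "card G \<le> Suc (b * (2 * b - 1)) ^ card C" .
  moreover have "finite G" using G fin by (rule finite_surj[rotated])
  moreover have "track_states C = insert None (Some ` G)" by (simp add: track_states_def G_def)
  ultimately show "finite (track_states C)"
    "card (track_states C) \<le> Suc (Suc (b * (2 * b - 1)) ^ card C)"
    by (auto simp: card_insert_if card_image)
qed

text \<open>The invariant is split in two: \<open>ordered\<close> survives every traversal, and
  \<open>within_bound\<close> is tested by \<open>track_upd\<close> itself. A visit preserves both,
  as it only extends ranges by the weight 0 and only at odd colors of \<open>V\<close>.\<close>

lemma track_memory_structure:
  assumes "E \<subseteq> V \<times> V" "finite V"
  shows "memory_structure V E (track_states {c \<in> \<Omega> ` V. odd c}) track_init track_upd"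
proof -
  define C where "C = {c \<in> \<Omega> ` V. odd c}"
  define ordered where "ordered g \<longleftrightarrow>
    (\<forall>c. g c \<noteq> None \<longrightarrow> c \<in> C) \<and> (\<forall>c l h. g c = Some (l, h) \<longrightarrow> l \<le> h)"
    for g :: "nat \<Rightarrow> (int \<times> int) option"
  have states: "Some g \<in> track_states C \<longleftrightarrow> ordered g \<and> within_bound g" for g
  proof -
    have "g c \<in> (if c \<in> C then bounds else {None}) \<longleftrightarrow> (g c \<noteq> None \<longrightarrow> c \<in> C) \<and>
      (\<forall>l h. g c = Some (l, h) \<longrightarrow> l \<le> h \<and> - int b < l \<and> h < int b)" for c
      by (cases "g c") (auto simp: bounds_def)
    then have "(\<forall>c. g c \<in> (if c \<in> C then bounds else {None})) \<longleftrightarrow> ordered g \<and> within_bound g"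
      unfolding ordered_def within_bound_def by blast
    moreover have "Some g \<in> track_states C \<longleftrightarrow> (\<forall>c. g c \<in> (if c \<in> C then bounds else {None}))"
      unfolding track_states_def by blast
    ultimately show ?thesis by simp
  qed
  have empty: "ordered (\<lambda>_. None)" "within_bound (\<lambda>_. None)"
    by (simp_all add: ordered_def within_bound_def)
  have visit: "ordered (visit v g)" "within_bound (visit v g)"
    if "v \<in> V" "ordered g" "within_bound g" for v g
    using that b_pos
    by (auto simp: ordered_def within_bound_def visit_def C_def min_def max_def
        split: option.splits if_splits)
  have traverse: "ordered (traverse x g)" if "ordered g" for x g
    using that by (auto simp: ordered_def traverse_def)
  have "track_init v \<in> track_states C" if "v \<in> V" for v
    using visit[OF that empty] by (simp add: track_init_def states)
  moreover have "track_upd m (v, v') \<in> track_states C"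
    if m: "m \<in> track_states C" and "(v, v') \<in> E" for m v v'
  proof -
    have "v \<in> V" "v' \<in> V" using that assms by auto
    then have "ordered (tracked v m)"
      using m visit[OF _ empty] by (auto simp: tracked_def states split: option.splits)
    then show ?thesis
      using visit[OF \<open>v' \<in> V\<close> traverse] states
      by (auto simp: track_upd_def Let_def) (simp add: track_states_def)
  qed
  moreover have "finite (track_states C)" using assms by (simp add: C_def track_states_card)
  ultimately show ?thesis unfolding memory_structure_def C_def by auto
qed

end

section \<open>From the given strategy to a finite-state one\<close>

theorem corollary9p12:
  fixes V V\<^sub>0 V\<^sub>1 :: "'v set" and E :: "('v \<times> 'v) set"
    and \<Omega> :: "'v \<Rightarrow> nat" and w :: "'v \<times> 'v \<Rightarrow> int"
    and n d b :: nat and v\<^sub>s :: 'v and \<tau> :: "'v list \<Rightarrow> 'v"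
  assumes "arena V V\<^sub>0 V\<^sub>1 E"
    and "n = card V"
    and "d = num_odd_colors V \<Omega>"
    and "v\<^sub>s \<in> V"
    and "strategy V E V\<^sub>1 \<tau>"
    and "Cost E V\<^sub>1 \<Omega> w v\<^sub>s \<tau> = enat b"
  shows "\<exists>\<tau>'. finite_state_strategy V E V\<^sub>1 \<tau>' (n * (2 * b\<^sup>2 + 3 * b + 2) ^ d) \<and>
              Cost E V\<^sub>1 \<Omega> w v\<^sub>s \<tau>' \<ge> enat b"
proof -
  have "finite V" and EV: "E \<subseteq> V \<times> V" and V1: "V\<^sub>1 \<subseteq> V"
    using arena.finite_vertices[OF assms(1)] arena.edges[OF assms(1)]
      arena.partition_union[OF assms(1)] by auto
  have "n \<ge> 1" using \<open>finite V\<close> assms(2,4) by (auto simp: Suc_le_eq card_gt_0_iff)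
  show ?thesis
  proof (cases "b = 0")
    \<comment> \<open>Every cost is at least 0, so any positional strategy will do, its single
      memory state padded to the required size.\<close>
    case True
    obtain sc where "\<And>v. v \<in> V\<^sub>1 \<Longrightarrow> (v, sc v) \<in> E"
      using arena.successor[OF assms(1)] V1 by (metis subsetD)
    then have "next_move E V\<^sub>1 (UNIV :: unit set) (\<lambda>v _. sc v)" by (simp add: next_move_def)
    moreover have "memory_structure V E (UNIV :: unit set) (\<lambda>_. ()) (\<lambda>_ _. ())"
      by (simp add: memory_structure_def)
    moreover have "card (UNIV :: unit set) \<le> n * (2 * b\<^sup>2 + 3 * b + 2) ^ d"
      using \<open>n \<ge> 1\<close> by (simp add: Suc_le_eq)
    ultimately obtain \<tau>' where "finite_state_strategy V E V\<^sub>1 \<tau>' (n * (2 * b\<^sup>2 + 3 * b + 2) ^ d)"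
      using implementation_with_nat_memory[OF assms(1)] by blast
    with True show ?thesis by (auto simp: enat_0)
  next
    case False
    then interpret request_tracking \<Omega> w b by unfold_locales simp
    define C where "C = {c \<in> \<Omega> ` V. odd c}"
    define M where "M = track_states C"
    define K where "K = Max (\<Omega> ` V)"
    define wins where
      "wins \<rho> \<longleftrightarrow> parity_wins True (\<lambda>k. track_color K (\<rho> k, track \<rho> k))" for \<rho>
    have "finite C" using \<open>finite V\<close> by (simp add: C_def)
    have d: "d = card C" by (simp add: assms(3) num_odd_colors_def C_def)
    have wins_iff: "wins \<rho> \<longleftrightarrow> enat b \<le> limsup (Cor \<Omega> w \<rho>)" if "play E \<rho>" for \<rho>
    proof -
      have "\<Omega> (\<rho> k) \<le> K" for k
        unfolding K_def using play_in_vertices[OF assms(1) that] \<open>finite V\<close> by simp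
      then show ?thesis unfolding wins_def limsup_Cor_ge_iff by (rule costly_iff_parity_wins[symmetric])
    qed
    have \<tau>_wins: "wins \<rho>" if "play E \<rho>" "\<rho> 0 = v\<^sub>s" "consistent V\<^sub>1 \<tau> \<rho>" for \<rho>
    proof -
      have "Cost E V\<^sub>1 \<Omega> w v\<^sub>s \<tau> \<le> limsup (Cor \<Omega> w \<rho>)"
        unfolding Cost_def using that by (intro Inf_lower) blast
      then show ?thesis using wins_iff that assms(6) by simp
    qed
    \<comment> \<open>The overflow state makes the memory bound one larger than a
      \<open>d\<close>-th power; strict monotonicity of powers absorbs this if
      \<open>d \<noteq> 0\<close>. As the cost is finite, it is not the infimum over no plays, so
      some play is consistent with \<tau>; it has a costly request, whose color is odd.\<close>
    have "C \<noteq> {}"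
    proof -
      have "\<exists>\<rho>. play E \<rho> \<and> \<rho> 0 = v\<^sub>s \<and> consistent V\<^sub>1 \<tau> \<rho>"
      proof (rule ccontr)
        assume "\<nexists>\<rho>. play E \<rho> \<and> \<rho> 0 = v\<^sub>s \<and> consistent V\<^sub>1 \<tau> \<rho>"
        then have "Cost E V\<^sub>1 \<Omega> w v\<^sub>s \<tau> = Inf {}" unfolding Cost_def by (intro arg_cong[of _ _ Inf]) blast
        with assms(6) show False by (simp add: top_enat_def)
      qed
      then obtain \<rho> where \<rho>: "play E \<rho>" "wins \<rho>" using \<tau>_wins by blast
      then obtain j where "costly \<rho> j"
        using wins_iff limsup_Cor_ge_iff by (metis INFM_E)
      then show ?thesis
        using costly_odd play_in_vertices[OF assms(1) \<rho>(1)] unfolding C_def by blast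
    qed
    then have "d \<noteq> 0" using d \<open>finite C\<close> by simp
    have M: "memory_structure V E M track_init track_upd"
      unfolding M_def C_def by (rule track_memory_structure[OF EV \<open>finite V\<close>])
    have "card M \<le> n * (2 * b\<^sup>2 + 3 * b + 2) ^ d"
    proof -
      have "card M \<le> Suc (Suc (b * (2 * b - 1)) ^ d)"
        unfolding M_def d by (rule track_states_card(2)[OF \<open>finite C\<close>])
      also have "\<dots> \<le> (2 * b\<^sup>2 + 3 * b + 2) ^ d"
      proof (rule Suc_leI, rule power_strict_mono)
        have "b * (2 * b - 1) \<le> b * (2 * b)" by (rule mult_le_mono2) simp
        also have "\<dots> = 2 * b\<^sup>2" by (simp add: power2_eq_square)
        finally show "Suc (b * (2 * b - 1)) < 2 * b\<^sup>2 + 3 * b + 2" by linarith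
      qed (use \<open>d \<noteq> 0\<close> in auto)
      also have "\<dots> \<le> n * (2 * b\<^sup>2 + 3 * b + 2) ^ d" using \<open>n \<ge> 1\<close> by simp
      finally show ?thesis .
    qed
    obtain nxt where nxt: "next_move E V\<^sub>1 M nxt"
      and nxt_wins: "\<And>\<rho>. play E \<rho> \<Longrightarrow> \<rho> 0 = v\<^sub>s \<Longrightarrow>
        \<forall>k. \<rho> k \<in> V\<^sub>1 \<longrightarrow> \<rho> (Suc k) = nxt (\<rho> k) (track \<rho> k) \<Longrightarrow> wins \<rho>"
      using finite_memory_determinacy[OF assms(1) M assms(4,5), of "track_color K"] \<tau>_wins
      unfolding wins_def by blast
    obtain \<tau>' where \<tau>': "finite_state_strategy V E V\<^sub>1 \<tau>' (n * (2 * b\<^sup>2 + 3 * b + 2) ^ d)"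
      "implements V E V\<^sub>1 track_init track_upd nxt \<tau>'"
      using implementation_with_nat_memory[OF assms(1) M nxt \<open>card M \<le> _\<close>] by blast
    have "enat b \<le> limsup (Cor \<Omega> w \<rho>)"
      if \<rho>: "play E \<rho>" "\<rho> 0 = v\<^sub>s" "consistent V\<^sub>1 \<tau>' \<rho>" for \<rho>
    proof -
      have "\<tau>' (map \<rho> [0..<Suc k]) = nxt (\<rho> k) (track \<rho> k)" if "\<rho> k \<in> V\<^sub>1" for k
        using \<tau>'(2) finite_path_prefix[OF assms(1) \<rho>(1), of k] that
        by (simp add: implements_def memory_at_def)
      then have "wins \<rho>" using nxt_wins[OF \<rho>(1,2)] \<rho>(3) by (simp add: consistent_def)
      then show ?thesis using wins_iff \<rho>(1) by simp
    qed
    then have "enat b \<le> Cost E V\<^sub>1 \<Omega> w v\<^sub>s \<tau>'"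
      unfolding Cost_def by (intro Inf_greatest) blast
    with \<tau>'(1) show ?thesis by blast
  qed
qed

end
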